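(* Let $N\ge 1$ and let $\mathcal{X}\subseteq\mathbb{Z}^n$, $\mathcal{U}\subseteq\mathbb{Z}^p$. Let $p_0(\mathbf{x}_0)$ be a pmf on $\mathcal X$, for $k=1,\dots,N$ let $p^{(x)}_{k\mid k-1}=p^{(x)}_k(\mathbf{x}_k\mid\mathbf{u}_k,\mathbf{x}_{k-1})$ be given conditional pmfs, let $c_k:\mathcal{X}\to\mathbb{R}$ be given costs, and let $$q_{0:N}=q_0(\mathbf{x}_0)\prod_{k=1}^N q^{(x)}_k(\mathbf{x}_k\mid\mathbf{u}_k,\mathbf{x}_{k-1})\,q^{(u)}_k(\mathbf{u}_k\mid\mathbf{x}_{k-1})$$ be a given joint pmf. For policies $\{p^{(u)}_{k\mid k-1}\}_{k=1}^N$, $p^{(u)}_{k\mid k-1}=p^{(u)}_k(\mathbf{u}_k\mid\mathbf{x}_{k-1})$, let $p_{0:N}=p_0(\mathbf{x}_0)\prod_{k=1}^N p^{(x)}_{k\mid k-1}p^{(u)}_{k\mid k-1}$. Consider the problem $$\min_{\{p^{(u)}_{k\mid k-1}\}_{1:N}}\Big\{\mathcal{D}_{\mathrm{KL}}(p_{0:N}\,\|\,q_{0:N})+\sum_{k=1}^N\mathbb{E}_{\bar p_{k-1:k}}\big[\mathbb{E}_{p^{(x)}_{k\mid k-1}}[c_k(\mathbf{X}_k)]\big]\Big\}\quad\text{s.t. } p^{(u)}_{k\mid k-1}\in\mathcal{D}\ \text{ for all } k,$$ and assume that its optimal cost is bounded. Then: (i) the problem has the unique solution $\{{p^{(u)}_{k\mid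 k-1}}^{\ast}\}_{1:N}$ with $${p^{(u)}_{k\mid k-1}}^{\ast}=\frac{\bar p^{(u)}_{k\mid k-1}\exp\big(-\mathbb{E}_{p^{(x)}_{k\mid k-1}}[\bar c_k(\mathbf{X}_k)]\big)}{\sum_{\mathbf{u}_k}\bar p^{(u)}_{k\mid k-1}\exp\big(-\mathbb{E}_{p^{(x)}_{k\mid k-1}}[\bar c_k(\mathbf{X}_k)]\big)},\qquad \bar p^{(u)}_{k\mid k-1}:=q^{(u)}_{k\mid k-1}\exp\big(-\mathcal{D}_{\mathrm{KL}}(p^{(x)}_{k\mid k-1}\,\|\,q^{(x)}_{k\mid k-1})\big),$$ where $\bar c_k:\mathcal{X}\to\mathbb{R}$ is obtained via the backward recursion $$\bar c_k(\mathbf{x}_k)=c_k(\mathbf{x}_k)-\hat c_k(\mathbf{x}_k),$$ $$\hat c_k(\mathbf{x}_k)=\ln\Big(\mathbb{E}_{q^{(u)}_{k+1\mid k}}\Big[\exp\Big(-\mathcal{D}_{\mathrm{KL}}(p^{(x)}_{k+1\mid k}\,\|\,q^{(x)}_{k+1\mid k})-\mathbb{E}_{p^{(x)}_{k+1\mid k}}[\bar c_{k+1}(\mathbf{X}_{k+1})]\Big)\Big]\Big),$$ with terminal condition $\mathcal{D}_{\mathrm{KL}}(p^{(x)}_{N+1\mid N}\,\|\,q^{(x)}_{N+1\mid N})+\mathbb{E}_{p^{(x)}_{N+1\mid N}}[\bar c_{N+1}(\mathbf{X}_{N+1})]=0$ (that is, $\hat c_N\equiv 0$); (ii) the corresponding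 minimum is given by $$-\sum_{k=1}^N\mathbb{E}_{\bar p_{k-1}}\big[\hat c_{k-1}(\mathbf{X}_{k-1})\big],\qquad \bar p_{k-1}:=p_{k-1}(\mathbf{x}_{k-1}).$$
   Context: $\mathbf{X}_k\in\mathcal{X}$ is the state and $\mathbf{U}_k\in\mathcal{U}$ the input at time $k$; when input $\mathbf{u}_k$ is applied the system goes from state $\mathbf{x}_{k-1}$ to state $\mathbf{x}_k$. "pmf" means probability mass function and $\mathcal{D}$ is the convex set of pmfs; $p^{(u)}_{k\mid k-1}\in\mathcal{D}$ means that for each $\mathbf{x}_{k-1}$, $p^{(u)}_k(\cdot\mid\mathbf{x}_{k-1})$ is a pmf in $\mathbf{u}_k$. Shorthand: $q^{(x)}_{k\mid k-1}:=q^{(x)}_k(\mathbf{x}_k\mid\mathbf{u}_k,\mathbf{x}_{k-1})$ and $q^{(u)}_{k\mid k-1}:=q^{(u)}_k(\mathbf{u}_k\mid\mathbf{x}_{k-1})$. The Kullback-Leibler divergence is $\mathcal{D}_{\mathrm{KL}}(p\,\|\,q):=\sum_{\mathbf{v}}p(\mathbf{v})\ln(p(\mathbf{v})/q(\mathbf{v}))$; in $\mathcal{D}_{\mathrm{KL}}(p^{(x)}_{k\mid k-1}\,\|\,q^{(x)}_{k\mid k-1})$ the sum is over $\mathbf{x}_k$, so it is a function of $(\mathbf{x}_{k-1},\mathbf{u}_k)$. Expectation: $\mathbb{E}_p[h(\mathbf{V})]=\sum_{\mathbf{v}}h(\mathbf{v})p(\mathbf{v})$, over the support of $p$; thus $\mathbb{E}_{p^{(x)}_{k\mid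 k-1}}[\cdot]$ is over $\mathbf{x}_k$ given $(\mathbf{x}_{k-1},\mathbf{u}_k)$, and $\mathbb{E}_{q^{(u)}_{k+1\mid k}}[\cdot]$ is over $\mathbf{u}_{k+1}$ given $\mathbf{x}_k$. $\bar p_{k-1:k}$ is the joint pmf of $(\mathbf{X}_{k-1},\mathbf{U}_k)$ and $\bar p_{k-1}=p_{k-1}(\mathbf{x}_{k-1})$ the marginal pmf of $\mathbf{X}_{k-1}$, both under $p_{0:N}$. All sums involving pmfs are assumed to exist.
   Formalization: The minimum in (ii) is corrected to KL(p_0||q_0) − E[ĉ_0] (the displayed sum counts later costs repeatedly: N=2, one state and input, p=q, c=1 gives 3, not 2); uniqueness in (i) is claimed only at states of positive probability under the optimal policy. *)

theory Defs
  imports "HOL-Probability.Probability"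
begin

text \<open>
  Argument order: \<open>px k u x\<close> is the pmf of the state at time \<open>k\<close> given the input \<open>u\<close> at
  time \<open>k\<close> and the state \<open>x\<close> at time \<open>k - 1\<close>; \<open>pu k x\<close> is the pmf of the input at time \<open>k\<close>
  given the state \<open>x\<close> at time \<open>k - 1\<close>.

  A trajectory up to time \<open>N\<close> is a pair \<open>(xs, us)\<close> with \<open>xs\<close> defined on \<open>{0..N}\<close> and \<open>us\<close>
  on \<open>{1..N}\<close>; both are \<open>undefined\<close> elsewhere, so that distinct trajectories are distinct
  pairs. The product form of the joint pmf is lemma \<open>pmf_joint_pmf\<close>.
\<close>

primrec joint_pmf ::
  "'x pmf \<Rightarrow> (nat \<Rightarrow> 'u \<Rightarrow> 'x \<Rightarrow> 'x pmf) \<Rightarrow> (nat \<Rightarrow> 'x \<Rightarrow> 'u pmf) \<Rightarrow> nat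
    \<Rightarrow> ((nat \<Rightarrow> 'x) \<times> (nat \<Rightarrow> 'u)) pmf" where
  "joint_pmf p0 px pu 0 = map_pmf (\<lambda>x. ((\<lambda>_. undefined)(0 := x), \<lambda>_. undefined)) p0"
| "joint_pmf p0 px pu (Suc k) =
     bind_pmf (joint_pmf p0 px pu k) (\<lambda>(xs, us).
     bind_pmf (pu (Suc k) (xs k)) (\<lambda>u.
     bind_pmf (px (Suc k) u (xs k)) (\<lambda>x.
     return_pmf (xs(Suc k := x), us(Suc k := u)))))"

definition state_marginal ::
  "'x pmf \<Rightarrow> (nat \<Rightarrow> 'u \<Rightarrow> 'x \<Rightarrow> 'x pmf) \<Rightarrow> (nat \<Rightarrow> 'x \<Rightarrow> 'u pmf) \<Rightarrow> nat \<Rightarrow> nat \<Rightarrow> 'x pmf" where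
  "state_marginal p0 px pu N k = map_pmf (\<lambda>(xs, us). xs k) (joint_pmf p0 px pu N)"

definition state_input_marginal ::
  "'x pmf \<Rightarrow> (nat \<Rightarrow> 'u \<Rightarrow> 'x \<Rightarrow> 'x pmf) \<Rightarrow> (nat \<Rightarrow> 'x \<Rightarrow> 'u pmf) \<Rightarrow> nat \<Rightarrow> nat
    \<Rightarrow> ('x \<times> 'u) pmf" where
  "state_input_marginal p0 px pu N k =
     map_pmf (\<lambda>(xs, us). (xs (k - 1), us k)) (joint_pmf p0 px pu N)"

lemma set_joint_pmf_extensional:
  "t \<in> set_pmf (joint_pmf p0 px pu N) \<Longrightarrow>
     fst t \<in> extensional {0..N} \<and> snd t \<in> extensional {1..N}"
proof (induction N arbitrary: t)
  case 0
  then show ?case by (auto simp: extensional_def)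
next
  case (Suc N)
  then show ?case by (fastforce simp: extensional_def)
qed

lemma pmf_bind_Pair:
  "pmf (bind_pmf p (\<lambda>a. map_pmf (Pair a) (f a))) (a, b) = pmf p a * pmf (f a) b"
proof -
  have *: "pmf (map_pmf (Pair x) (f x)) (a, b) = indicator {a} x * pmf (f a) b" for x
    by (cases "x = a") (auto simp: pmf_map_inj' inj_on_def pmf_eq_0_set_pmf)
  show ?thesis
    by (simp only: pmf_bind *) (simp add: measure_pmf_single)
qed

lemma pmf_joint_pmf:
  assumes "xs \<in> extensional {0..N}" "us \<in> extensional {1..N}"
  shows "pmf (joint_pmf p0 px pu N) (xs, us) =
    pmf p0 (xs 0) *
    (\<Prod>k=1..N. pmf (px k (us k) (xs (k - 1))) (xs k) * pmf (pu k (xs (k - 1))) (us k))"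
  using assms
proof (induction N arbitrary: xs us)
  case 0
  let ?f = "\<lambda>x. ((\<lambda>_::nat. undefined)(0 := x), \<lambda>_::nat. undefined)"
  have "inj ?f"
    by (auto simp: inj_on_def fun_eq_iff)
  moreover have "(xs, us) = ?f (xs 0)"
    using 0 by (auto simp: extensional_def fun_eq_iff)
  ultimately show ?case
    using pmf_map_inj'[of ?f p0 "xs 0"] by simp
next
  case (Suc N)
  let ?J = "joint_pmf p0 px pu N"
  let ?g = "\<lambda>t. bind_pmf (pu (Suc N) (fst t N)) (\<lambda>u. map_pmf (Pair u) (px (Suc N) u (fst t N)))"
  let ?P = "bind_pmf ?J (\<lambda>t. map_pmf (Pair t) (?g t))"
  let ?h = "\<lambda>(t, b). ((fst t)(Suc N := snd b), (snd t)(Suc N := fst b))"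
  let ?xs = "xs(Suc N := undefined)" and ?us = "us(Suc N := undefined)"
  let ?t = "((?xs, ?us), (us (Suc N), xs (Suc N)))"
  have J: "joint_pmf p0 px pu (Suc N) = map_pmf ?h ?P"
    by (simp add: map_bind_pmf bind_map_pmf map_pmf_def bind_assoc_pmf bind_return_pmf
        case_prod_unfold)
  have ext: "?xs \<in> extensional {0..N}" "?us \<in> extensional {1..N}"
    using Suc.prems by (auto simp: extensional_def)
  have ht: "?h ?t = (xs, us)"
    by simp
  have 1: "s = ?t" if s: "s \<in> set_pmf ?P" "?h s = (xs, us)" for s
  proof -
    obtain xs' us' u x where s_eq: "s = ((xs', us'), (u, x))"
      by (metis surj_pair)
    have "(xs', us') \<in> set_pmf ?J"
      using s(1) by (auto simp: s_eq)
    then have "xs' (Suc N) = undefined" "us' (Suc N) = undefined"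
      using set_joint_pmf_extensional[of "(xs', us')" p0 px pu N] by (auto simp: extensional_def)
    then have "xs'(Suc N := undefined) = xs'" "us'(Suc N := undefined) = us'"
      by (simp_all add: fun_upd_idem)
    moreover have "xs = xs'(Suc N := x)" "us = us'(Suc N := u)"
      using s(2) unfolding s_eq by simp_all
    ultimately show ?thesis
      unfolding s_eq by simp
  qed
  have "pmf (joint_pmf p0 px pu (Suc N)) (xs, us) = measure (measure_pmf ?P) (?h -` {(xs, us)})"
    unfolding J by (rule pmf_map)
  also have "\<dots> = measure (measure_pmf ?P) {?t}"
    by (rule measure_pmf.finite_measure_eq_AE)
      (use 1 ht in \<open>simp_all only: AE_measure_pmf_iff sets_measure_pmf UNIV_I vimage_def
          mem_Collect_eq singleton_iff, blast\<close>)
  also have "\<dots> = pmf ?P ?t"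
    by (simp add: pmf.rep_eq)
  also have "\<dots> = pmf ?J (?xs, ?us) * (pmf (pu (Suc N) (xs N)) (us (Suc N)) *
      pmf (px (Suc N) (us (Suc N)) (xs N)) (xs (Suc N)))"
    by (simp add: pmf_bind_Pair)
  also have "pmf ?J (?xs, ?us) = pmf p0 (xs 0) *
    (\<Prod>k=1..N. pmf (px k (us k) (xs (k - 1))) (xs k) * pmf (pu k (xs (k - 1))) (us k))"
    unfolding Suc.IH[OF ext] by (auto intro!: prod.cong)
  finally show ?case
    by (simp add: mult_ac)
qed

text \<open>
  The negative part of the sum defining the divergence always converges when the support of
  \<open>p\<close> is contained in that of \<open>q\<close>, so a sum that does not converge has value \<open>\<infinity>\<close>.
  The library's \<open>KL_divergence\<close> is not used because it is real-valued, with value \<open>0\<close> in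
  place of \<open>\<infinity>\<close>.
\<close>

definition kl :: "'a pmf \<Rightarrow> 'a pmf \<Rightarrow> ereal" where
  "kl p q =
     (if set_pmf p \<subseteq> set_pmf q \<and> (\<lambda>v. pmf p v * ln (pmf p v / pmf q v)) summable_on UNIV
      then ereal (\<Sum>\<^sub>\<infinity>v. pmf p v * ln (pmf p v / pmf q v))
      else \<infinity>)"

text \<open>
  Extended expectation. As \<open>\<infinity> - \<infinity> = \<infinity> + (- \<infinity>) = \<infinity>\<close> in \<open>ereal\<close>, a policy for
  which the objective below is an indeterminate expression has cost \<open>\<infinity>\<close>, that is, it does
  not compete in the minimization.
\<close>

definition ext_expectation :: "'a pmf \<Rightarrow> ('a \<Rightarrow> real) \<Rightarrow> ereal" where
  "ext_expectation p h =
     enn2ereal (\<integral>\<^sup>+ v. ennreal (h v) \<partial>measure_pmf p)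
     - enn2ereal (\<integral>\<^sup>+ v. ennreal (- h v) \<partial>measure_pmf p)"

definition policies :: "nat \<Rightarrow> 'x set \<Rightarrow> 'u set \<Rightarrow> (nat \<Rightarrow> 'x \<Rightarrow> 'u pmf) set" where
  "policies N X U = {pu. \<forall>k\<in>{1..N}. \<forall>x\<in>X. set_pmf (pu k x) \<subseteq> U}"

definition objective ::
  "nat \<Rightarrow> 'x pmf \<Rightarrow> (nat \<Rightarrow> 'u \<Rightarrow> 'x \<Rightarrow> 'x pmf) \<Rightarrow> 'x pmf \<Rightarrow> (nat \<Rightarrow> 'u \<Rightarrow> 'x \<Rightarrow> 'x pmf)
    \<Rightarrow> (nat \<Rightarrow> 'x \<Rightarrow> 'u pmf) \<Rightarrow> (nat \<Rightarrow> 'x \<Rightarrow> real) \<Rightarrow> (nat \<Rightarrow> 'x \<Rightarrow> 'u pmf) \<Rightarrow> ereal" where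
  "objective N p0 px q0 qx qu c pu =
     kl (joint_pmf p0 px pu N) (joint_pmf q0 qx qu N)
     + (\<Sum>k=1..N. ext_expectation (state_input_marginal p0 px pu N k)
          (\<lambda>(x, u). measure_pmf.expectation (px k u x) (c k)))"

function chat ::
  "nat \<Rightarrow> (nat \<Rightarrow> 'u \<Rightarrow> 'x \<Rightarrow> 'x pmf) \<Rightarrow> (nat \<Rightarrow> 'u \<Rightarrow> 'x \<Rightarrow> 'x pmf) \<Rightarrow> (nat \<Rightarrow> 'x \<Rightarrow> 'u pmf)
    \<Rightarrow> (nat \<Rightarrow> 'x \<Rightarrow> real) \<Rightarrow> nat \<Rightarrow> 'x \<Rightarrow> real" where
  "chat N px qx qu c k x =
     (if N \<le> k then 0
      else ln (measure_pmf.expectation (qu (Suc k) x) (\<lambda>u.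
        exp (- real_of_ereal (kl (px (Suc k) u x) (qx (Suc k) u x))
             - measure_pmf.expectation (px (Suc k) u x)
                 (\<lambda>y. c (Suc k) y - chat N px qx qu c (Suc k) y)))))"
  by pat_completeness auto
termination
  by (relation "Wellfounded.measure (\<lambda>(N, px, qx, qu, c, k, x). N - k)") auto

declare chat.simps [simp del]

definition cbar ::
  "nat \<Rightarrow> (nat \<Rightarrow> 'u \<Rightarrow> 'x \<Rightarrow> 'x pmf) \<Rightarrow> (nat \<Rightarrow> 'u \<Rightarrow> 'x \<Rightarrow> 'x pmf) \<Rightarrow> (nat \<Rightarrow> 'x \<Rightarrow> 'u pmf)
    \<Rightarrow> (nat \<Rightarrow> 'x \<Rightarrow> real) \<Rightarrow> nat \<Rightarrow> 'x \<Rightarrow> real" where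
  "cbar N px qx qu c k x = c k x - chat N px qx qu c k x"

lemma chat_terminal: "chat N px qx qu c N x = 0"
  by (simp add: chat.simps)

lemma chat_rec:
  "k < N \<Longrightarrow> chat N px qx qu c k x =
     ln (measure_pmf.expectation (qu (Suc k) x) (\<lambda>u.
       exp (- real_of_ereal (kl (px (Suc k) u x) (qx (Suc k) u x))
            - measure_pmf.expectation (px (Suc k) u x) (cbar N px qx qu c (Suc k)))))"
  by (subst chat.simps) (simp add: cbar_def[abs_def])

definition pu_bar ::
  "(nat \<Rightarrow> 'u \<Rightarrow> 'x \<Rightarrow> 'x pmf) \<Rightarrow> (nat \<Rightarrow> 'u \<Rightarrow> 'x \<Rightarrow> 'x pmf) \<Rightarrow> (nat \<Rightarrow> 'x \<Rightarrow> 'u pmf)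
    \<Rightarrow> nat \<Rightarrow> 'x \<Rightarrow> 'u \<Rightarrow> real" where
  "pu_bar px qx qu k x u = pmf (qu k x) u * exp (- real_of_ereal (kl (px k u x) (qx k u x)))"

definition pu_star ::
  "nat \<Rightarrow> (nat \<Rightarrow> 'u \<Rightarrow> 'x \<Rightarrow> 'x pmf) \<Rightarrow> (nat \<Rightarrow> 'u \<Rightarrow> 'x \<Rightarrow> 'x pmf) \<Rightarrow> (nat \<Rightarrow> 'x \<Rightarrow> 'u pmf)
    \<Rightarrow> (nat \<Rightarrow> 'x \<Rightarrow> real) \<Rightarrow> nat \<Rightarrow> 'x \<Rightarrow> 'u \<Rightarrow> real" where
  "pu_star N px qx qu c k x u =
     pu_bar px qx qu k x u * exp (- measure_pmf.expectation (px k u x) (cbar N px qx qu c k))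
     / (\<Sum>\<^sub>\<infinity>v. pu_bar px qx qu k x v
               * exp (- measure_pmf.expectation (px k v x) (cbar N px qx qu c k)))"

text \<open>
  \<open>embed_pmf\<close> is meaningful only when its argument is nonnegative with sum \<open>1\<close>; that this
  holds for \<open>pu_star\<close> has to be proved from the hypotheses under which it is used.
\<close>

definition opt_policy ::
  "nat \<Rightarrow> (nat \<Rightarrow> 'u \<Rightarrow> 'x \<Rightarrow> 'x pmf) \<Rightarrow> (nat \<Rightarrow> 'u \<Rightarrow> 'x \<Rightarrow> 'x pmf) \<Rightarrow> (nat \<Rightarrow> 'x \<Rightarrow> 'u pmf)
    \<Rightarrow> (nat \<Rightarrow> 'x \<Rightarrow> real) \<Rightarrow> nat \<Rightarrow> 'x \<Rightarrow> 'u pmf" where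
  "opt_policy N px qx qu c k x = embed_pmf (pu_star N px qx qu c k x)"

end

theory Submission
  imports Defs
begin

text \<open>
  On the support of a feasible policy \<open>pu\<close>, the one-stage log-ratio of \<open>pu\<close> to the candidate
  equals its log-ratio to \<open>qu\<close>, plus the divergence of the transition, plus the stage cost,
  minus the conditional mean of \<open>chat k\<close>, plus \<open>chat (k - 1)\<close>. Taking expectations and
  summing over the stages, the \<open>chat\<close> terms telescope, and by the chain rule the objective is
  \<open>kl p0 q0 - E chat 0\<close> plus a sum of conditional divergences from \<open>pu\<close> to the candidate,
  which are nonnegative and vanish only if the two policies agree on the visited states.

  The difficulty is integrability, as \<open>chat k\<close> is only known to be integrable conditionally. The
  negative part of a log-likelihood ratio always has a finite integral. A backward induction
  along the candidate, where the log-ratio to the candidate is zero, therefore bounds the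
  positive part of \<open>chat\<close>; a backward induction along any policy of finite cost bounds the
  negative part. Both apply to \<open>chat 0\<close>, whose law does not depend on the policy, so it is
  integrable, and a forward induction carries integrability to the later stages.

  The one-stage problems of the backward recursion are the case of horizon \<open>1\<close> with equal
  initial pmfs.
\<close>

section \<open>Integrals with respect to probability mass functions\<close>

lemma integrable_pmf_bound:
  fixes f g :: "'a \<Rightarrow> real"
  assumes "integrable (measure_pmf p) g" "\<And>x. x \<in> set_pmf p \<Longrightarrow> \<bar>f x\<bar> \<le> g x"
  shows "integrable (measure_pmf p) f"
  by (rule Bochner_Integration.integrable_bound[OF assms(1)])
    (use assms(2) in \<open>force simp: AE_measure_pmf_iff\<close>)+

lemma integrable_pmf_cong:
  fixes f g :: "'a \<Rightarrow> real"
  assumes "\<And>x. x \<in> set_pmf p \<Longrightarrow> f x = g x"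
  shows "integrable (measure_pmf p) f \<longleftrightarrow> integrable (measure_pmf p) g"
  by (rule integrable_cong_AE) (use assms in \<open>auto simp: AE_measure_pmf_iff\<close>)

lemma integral_pmf_cong:
  fixes f g :: "'a \<Rightarrow> real"
  assumes "\<And>x. x \<in> set_pmf p \<Longrightarrow> f x = g x"
  shows "measure_pmf.expectation p f = measure_pmf.expectation p g"
  by (rule integral_cong_AE) (use assms in \<open>auto simp: AE_measure_pmf_iff\<close>)

lemma integral_pmf_mono:
  fixes f g :: "'a \<Rightarrow> real"
  assumes "integrable (measure_pmf p) f" "integrable (measure_pmf p) g"
    "\<And>x. x \<in> set_pmf p \<Longrightarrow> f x \<le> g x"
  shows "measure_pmf.expectation p f \<le> measure_pmf.expectation p g"
  by (rule integral_mono_AE) (use assms in \<open>auto simp: AE_measure_pmf_iff\<close>)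

lemma integral_pmf_nonneg:
  fixes f :: "'a \<Rightarrow> real"
  assumes "\<And>x. x \<in> set_pmf p \<Longrightarrow> 0 \<le> f x"
  shows "0 \<le> measure_pmf.expectation p f"
  by (rule integral_nonneg_AE) (use assms in \<open>auto simp: AE_measure_pmf_iff\<close>)

lemma integrable_pos_neg_parts:
  fixes f :: "'a \<Rightarrow> real"
  shows "integrable (measure_pmf p) f \<longleftrightarrow>
    integrable (measure_pmf p) (\<lambda>x. max 0 (f x)) \<and> integrable (measure_pmf p) (\<lambda>x. max 0 (- f x))"
    (is "_ \<longleftrightarrow> ?r")
proof
  assume f: "integrable (measure_pmf p) f"
  then show ?r
    by (intro conjI) (rule integrable_pmf_bound[OF integrable_abs[OF f]]; simp)+
next
  assume ?r
  then have "integrable (measure_pmf p) (\<lambda>x. max 0 (f x) - max 0 (- f x))"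
    by (intro Bochner_Integration.integrable_diff) auto
  then show "integrable (measure_pmf p) f"
    by (rule integrable_pmf_bound[OF integrable_abs]) auto
qed

text \<open>Tonelli for a mixture. An almost sure statement about a pmf concerns every point of its
  support, so a finite iterated integral makes every conditional integral finite. The clause on the
  kernels has to stand on the right-hand side, since the expectation of a non-integrable function
  defaults to 0.\<close>

lemma integrable_bind_pmf_nonneg_iff:
  fixes f :: "'b \<Rightarrow> real"
  assumes f: "\<And>y. y \<in> set_pmf (bind_pmf p K) \<Longrightarrow> 0 \<le> f y"
  shows "integrable (measure_pmf (bind_pmf p K)) f \<longleftrightarrow>
    (\<forall>a\<in>set_pmf p. integrable (measure_pmf (K a)) f) \<and>
    integrable (measure_pmf p) (\<lambda>a. measure_pmf.expectation (K a) f)" (is "?l \<longleftrightarrow> ?r")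
proof -
  have nn: "(\<integral>\<^sup>+ y. ennreal (norm (f y)) \<partial>measure_pmf (K a)) = (\<integral>\<^sup>+ y. ennreal (f y) \<partial>measure_pmf (K a))"
    if "a \<in> set_pmf p" for a
    by (rule nn_integral_cong_AE) (use that f in \<open>fastforce simp: AE_measure_pmf_iff\<close>)
  have l: "?l \<longleftrightarrow> (\<integral>\<^sup>+ a. \<integral>\<^sup>+ y. ennreal (norm (f y)) \<partial>measure_pmf (K a) \<partial>measure_pmf p) < \<infinity>"
    by (simp add: integrable_iff_bounded)
  have r: "(\<forall>a\<in>set_pmf p. integrable (measure_pmf (K a)) f)" if ?l
  proof
    fix a assume a: "a \<in> set_pmf p"
    have "AE a in measure_pmf p. (\<integral>\<^sup>+ y. ennreal (norm (f y)) \<partial>measure_pmf (K a)) \<noteq> \<infinity>"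
      by (rule nn_integral_PInf_AE) (use that l in auto)
    then show "integrable (measure_pmf (K a)) f"
      using a by (auto simp: AE_measure_pmf_iff integrable_iff_bounded less_top)
  qed
  have "(\<integral>\<^sup>+ a. \<integral>\<^sup>+ y. ennreal (norm (f y)) \<partial>measure_pmf (K a) \<partial>measure_pmf p)
      = (\<integral>\<^sup>+ a. ennreal (norm (measure_pmf.expectation (K a) f)) \<partial>measure_pmf p)"
    if *: "\<forall>a\<in>set_pmf p. integrable (measure_pmf (K a)) f"
  proof (rule nn_integral_cong_AE, unfold AE_measure_pmf_iff, intro ballI)
    fix a assume a: "a \<in> set_pmf p"
    have "(\<integral>\<^sup>+ y. ennreal (f y) \<partial>measure_pmf (K a)) = ennreal (measure_pmf.expectation (K a) f)"
      by (rule nn_integral_eq_integral) (use a * f in \<open>auto simp: AE_measure_pmf_iff\<close>)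
    moreover have "0 \<le> measure_pmf.expectation (K a) f"
      by (rule integral_pmf_nonneg) (use a f in auto)
    ultimately show "(\<integral>\<^sup>+ y. ennreal (norm (f y)) \<partial>measure_pmf (K a))
        = ennreal (norm (measure_pmf.expectation (K a) f))"
      using nn[OF a] by simp
  qed
  then show ?thesis
    using l r by (auto simp: integrable_iff_bounded[where M = "measure_pmf p"])
qed

lemma integral_bind_pmf_nonneg:
  fixes f :: "'b \<Rightarrow> real"
  assumes f: "\<And>y. y \<in> set_pmf (bind_pmf p K) \<Longrightarrow> 0 \<le> f y"
    and int: "integrable (measure_pmf (bind_pmf p K)) f"
  shows "measure_pmf.expectation (bind_pmf p K) f
    = measure_pmf.expectation p (\<lambda>a. measure_pmf.expectation (K a) f)"
proof -
  have *: "\<forall>a\<in>set_pmf p. integrable (measure_pmf (K a)) f"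
    using int integrable_bind_pmf_nonneg_iff[of p K f] f by blast
  have "(\<integral>\<^sup>+ y. ennreal (f y) \<partial>measure_pmf (K a)) = ennreal (measure_pmf.expectation (K a) f)"
    if "a \<in> set_pmf p" for a
    by (rule nn_integral_eq_integral) (use that * f in \<open>auto simp: AE_measure_pmf_iff\<close>)
  then have "(\<integral>\<^sup>+ a. \<integral>\<^sup>+ y. ennreal (f y) \<partial>measure_pmf (K a) \<partial>measure_pmf p)
      = (\<integral>\<^sup>+ a. ennreal (measure_pmf.expectation (K a) f) \<partial>measure_pmf p)"
    by (intro nn_integral_cong_AE) (auto simp: AE_measure_pmf_iff)
  moreover have "measure_pmf.expectation (bind_pmf p K) f
      = enn2real (\<integral>\<^sup>+ y. ennreal (f y) \<partial>measure_pmf (bind_pmf p K))"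
    by (rule integral_eq_nn_integral) (use f in \<open>auto simp: AE_measure_pmf_iff\<close>)
  moreover have "measure_pmf.expectation p (\<lambda>a. measure_pmf.expectation (K a) f)
      = enn2real (\<integral>\<^sup>+ a. ennreal (measure_pmf.expectation (K a) f) \<partial>measure_pmf p)"
    by (rule integral_eq_nn_integral)
      (use f in \<open>auto simp: AE_measure_pmf_iff intro!: integral_pmf_nonneg\<close>)
  ultimately show ?thesis
    by simp
qed

text \<open>Fubini, by applying Tonelli to the positive and the negative part. The converse fails in
  general, as cancellation inside the kernels can hide divergence.\<close>

lemma integrable_bind_pmfD:
  fixes f :: "'b \<Rightarrow> real"
  assumes "integrable (measure_pmf (bind_pmf p K)) f"
  shows "a \<in> set_pmf p \<Longrightarrow> integrable (measure_pmf (K a)) f"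
    and "integrable (measure_pmf p) (\<lambda>a. measure_pmf.expectation (K a) f)"
    and "measure_pmf.expectation (bind_pmf p K) f
      = measure_pmf.expectation p (\<lambda>a. measure_pmf.expectation (K a) f)"
proof -
  let ?f = "\<lambda>y. max 0 (f y)" and ?g = "\<lambda>y. max 0 (- f y)"
  have i: "integrable (measure_pmf (bind_pmf p K)) ?f" "integrable (measure_pmf (bind_pmf p K)) ?g"
    using assms integrable_pos_neg_parts by blast+
  then have i': "\<forall>a\<in>set_pmf p. integrable (measure_pmf (K a)) ?f"
      "integrable (measure_pmf p) (\<lambda>a. measure_pmf.expectation (K a) ?f)"
      "\<forall>a\<in>set_pmf p. integrable (measure_pmf (K a)) ?g"
      "integrable (measure_pmf p) (\<lambda>a. measure_pmf.expectation (K a) ?g)"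
    using integrable_bind_pmf_nonneg_iff[of p K ?f] integrable_bind_pmf_nonneg_iff[of p K ?g] by auto
  show *: "integrable (measure_pmf (K a)) f" if "a \<in> set_pmf p" for a
    using i' that integrable_pos_neg_parts[of "K a" f] by blast
  have eq: "f = (\<lambda>y. ?f y - ?g y)"
    by auto
  have K: "measure_pmf.expectation (K a) f
      = measure_pmf.expectation (K a) ?f - measure_pmf.expectation (K a) ?g"
    if "a \<in> set_pmf p" for a
    by (subst eq, rule Bochner_Integration.integral_diff) (use i' that in auto)
  have d: "integrable (measure_pmf p)
      (\<lambda>a. measure_pmf.expectation (K a) ?f - measure_pmf.expectation (K a) ?g)"
    using i' by (intro Bochner_Integration.integrable_diff) auto
  then show "integrable (measure_pmf p) (\<lambda>a. measure_pmf.expectation (K a) f)"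
    by (subst integrable_pmf_cong[OF K]) auto
  have "measure_pmf.expectation (bind_pmf p K) f
      = measure_pmf.expectation (bind_pmf p K) ?f - measure_pmf.expectation (bind_pmf p K) ?g"
    by (subst eq, rule Bochner_Integration.integral_diff) (use i in auto)
  also have "\<dots> = measure_pmf.expectation p (\<lambda>a. measure_pmf.expectation (K a) ?f)
      - measure_pmf.expectation p (\<lambda>a. measure_pmf.expectation (K a) ?g)"
    using i by (simp add: integral_bind_pmf_nonneg)
  also have "\<dots> = measure_pmf.expectation p
      (\<lambda>a. measure_pmf.expectation (K a) ?f - measure_pmf.expectation (K a) ?g)"
    by (rule Bochner_Integration.integral_diff[symmetric]) (use i' in auto)
  also have "\<dots> = measure_pmf.expectation p (\<lambda>a. measure_pmf.expectation (K a) f)"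
    by (rule integral_pmf_cong) (use K in auto)
  finally show "measure_pmf.expectation (bind_pmf p K) f
      = measure_pmf.expectation p (\<lambda>a. measure_pmf.expectation (K a) f)" .
qed

text \<open>Jensen's inequality for \<open>max 0\<close>: the positive part of a conditional mean is
  at most the conditional mean of the positive part.\<close>

lemma integrable_pos_part_conditional:
  fixes f :: "'b \<Rightarrow> real"
  assumes "integrable (measure_pmf (bind_pmf p K)) (\<lambda>y. max 0 (f y))"
    and f: "\<And>a. a \<in> set_pmf p \<Longrightarrow> integrable (measure_pmf (K a)) f"
  shows "integrable (measure_pmf p) (\<lambda>a. max 0 (measure_pmf.expectation (K a) f))"
proof (rule integrable_pmf_bound[OF integrable_bind_pmfD(2)[of p K, OF assms(1)]])
  fix a assume a: "a \<in> set_pmf p"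
  have "measure_pmf.expectation (K a) f \<le> measure_pmf.expectation (K a) (\<lambda>y. max 0 (f y))"
    using f[OF a] by (intro integral_pmf_mono) auto
  moreover have "0 \<le> measure_pmf.expectation (K a) (\<lambda>y. max 0 (f y))"
    by (rule integral_pmf_nonneg) auto
  ultimately show "\<bar>max 0 (measure_pmf.expectation (K a) f)\<bar>
      \<le> measure_pmf.expectation (K a) (\<lambda>y. max 0 (f y))"
    by auto
qed

text \<open>A one-sided converse of Fubini: the conditional mean of the negative part is that of the
  positive part minus that of \<open>f\<close>, hence integrable, and Tonelli applies to the
  negative part.\<close>

lemma integrable_bind_pmf_pos_part:
  fixes f :: "'b \<Rightarrow> real"
  assumes pos: "integrable (measure_pmf (bind_pmf p K)) (\<lambda>y. max 0 (f y))"
    and f: "\<And>a. a \<in> set_pmf p \<Longrightarrow> integrable (measure_pmf (K a)) f"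
    and cond: "integrable (measure_pmf p) (\<lambda>a. measure_pmf.expectation (K a) f)"
  shows "integrable (measure_pmf (bind_pmf p K)) f"
proof -
  let ?f = "\<lambda>y. max 0 (f y)" and ?g = "\<lambda>y. max 0 (- f y)"
  have fg: "integrable (measure_pmf (K a)) ?f" "integrable (measure_pmf (K a)) ?g"
    if "a \<in> set_pmf p" for a
    using f[OF that] by simp_all
  have g: "measure_pmf.expectation (K a) ?g
      = measure_pmf.expectation (K a) ?f - measure_pmf.expectation (K a) f"
    if a: "a \<in> set_pmf p" for a
  proof -
    have "?g = (\<lambda>y. ?f y - f y)"
      by auto
    then show ?thesis
      by (simp only: Bochner_Integration.integral_diff[OF fg(1)[OF a] f[OF a]])
  qed
  have "integrable (measure_pmf p) (\<lambda>a. measure_pmf.expectation (K a) ?g)"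
    by (subst integrable_pmf_cong[OF g])
      (use integrable_bind_pmfD(2)[of p K, OF pos] cond in \<open>auto intro: Bochner_Integration.integrable_diff\<close>)
  then have "integrable (measure_pmf (bind_pmf p K)) ?g"
    using fg by (subst integrable_bind_pmf_nonneg_iff) auto
  then show ?thesis
    using pos integrable_pos_neg_parts by blast
qed

lemma integrable_bind_pmf_neg_part:
  fixes f :: "'b \<Rightarrow> real"
  assumes neg: "integrable (measure_pmf (bind_pmf p K)) (\<lambda>y. max 0 (- f y))"
    and f: "\<And>a. a \<in> set_pmf p \<Longrightarrow> integrable (measure_pmf (K a)) f"
    and cond: "integrable (measure_pmf p) (\<lambda>a. measure_pmf.expectation (K a) f)"
  shows "integrable (measure_pmf (bind_pmf p K)) f"
  using integrable_bind_pmf_pos_part[of p K "\<lambda>y. - f y"] assms by simp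

text \<open>Cancellation in \<open>f + g\<close> is limited by the negative parts:
  \<open>f = (f + g) - g\<close> is at most \<open>|f + g| + max 0 (- g)\<close>. This splits sums
  that contain log-likelihood ratios.\<close>

lemma integrable_add_lower_bounded:
  fixes f g :: "'a \<Rightarrow> real"
  assumes "integrable (measure_pmf p) (\<lambda>x. f x + g x)"
    "integrable (measure_pmf p) (\<lambda>x. max 0 (- f x))" "integrable (measure_pmf p) (\<lambda>x. max 0 (- g x))"
  shows "integrable (measure_pmf p) f" "integrable (measure_pmf p) g"
proof -
  have i: "integrable (measure_pmf p) (\<lambda>x. \<bar>f x + g x\<bar> + (max 0 (- f x) + max 0 (- g x)))"
    by (intro Bochner_Integration.integrable_add[OF integrable_abs[OF assms(1)]]
        Bochner_Integration.integrable_add[OF assms(2,3)])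
  show "integrable (measure_pmf p) f" "integrable (measure_pmf p) g"
    by (rule integrable_pmf_bound[OF i]; simp)+
qed

section \<open>Log-likelihood ratios and the chain rule\<close>

definition lr :: "'a pmf \<Rightarrow> 'a pmf \<Rightarrow> 'a \<Rightarrow> real" where
  "lr p q v = ln (pmf p v / pmf q v)"

text \<open>Connects the infinite sum in \<open>kl\<close> with Bochner integrals: summability of
  reals is absolute, and \<open>pmf p\<close> is a density with respect to the counting
  measure.\<close>

lemma summable_on_pmf_iff:
  fixes f :: "'a \<Rightarrow> real"
  shows "(\<lambda>v. pmf p v * f v) summable_on UNIV \<longleftrightarrow> integrable (measure_pmf p) f"
proof -
  have "(\<lambda>v. pmf p v * f v) summable_on UNIV \<longleftrightarrow> integrable (count_space UNIV) (\<lambda>v. pmf p v * f v)"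
    using summable_on_iff_abs_summable_on_real[of "\<lambda>v. pmf p v * f v" UNIV]
      abs_summable_equivalent[of "\<lambda>v. pmf p v * f v" UNIV]
    unfolding abs_summable_on_def by blast
  also have "\<dots> \<longleftrightarrow> integrable (measure_pmf p) f"
    by (simp add: measure_pmf_eq_density integrable_density)
  finally show ?thesis .
qed

lemma infsum_pmf_eq:
  fixes f :: "'a \<Rightarrow> real"
  assumes "integrable (measure_pmf p) f"
  shows "(\<Sum>\<^sub>\<infinity>v. pmf p v * f v) = measure_pmf.expectation p f"
proof -
  have "Infinite_Set_Sum.abs_summable_on (\<lambda>v. pmf p v * f v) UNIV"
    using assms summable_on_pmf_iff[of p f]
      summable_on_iff_abs_summable_on_real[of "\<lambda>v. pmf p v * f v" UNIV]
      abs_summable_equivalent[of "\<lambda>v. pmf p v * f v" UNIV] by blast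
  then have "(\<Sum>\<^sub>\<infinity>v. pmf p v * f v) = infsetsum (\<lambda>v. pmf p v * f v) UNIV"
    by (rule infsetsum_infsum[symmetric])
  also have "\<dots> = measure_pmf.expectation p f"
    by (simp add: infsetsum_def measure_pmf_eq_density integral_density)
  finally show ?thesis .
qed

lemma kl_finite_iff: "kl p q \<noteq> \<infinity> \<longleftrightarrow> set_pmf p \<subseteq> set_pmf q \<and> integrable (measure_pmf p) (lr p q)"
  by (simp add: kl_def summable_on_pmf_iff lr_def[abs_def])

lemma kl_eq: "kl p q \<noteq> \<infinity> \<Longrightarrow> kl p q = ereal (measure_pmf.expectation p (lr p q))"
  using infsum_pmf_eq[of p "lr p q"]
  by (auto simp: kl_def summable_on_pmf_iff lr_def[abs_def] split: if_splits)

text \<open>The quotient cancels only on the support of \<open>p\<close>, so its mean is the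
  \<open>q\<close>-mass of that support and may be less than 1. \<open>integral_lr\<close> uses this
  deficit in its equality case.\<close>

lemma integrable_ratio_pmf:
  "integrable (measure_pmf p) (\<lambda>v. pmf q v / pmf p v)"
  "measure_pmf.expectation p (\<lambda>v. pmf q v / pmf p v) = measure_pmf.prob q (set_pmf p)"
proof -
  have eq: "pmf p v * (pmf q v / pmf p v) = pmf q v * indicator (set_pmf p) v" for v
    by (auto simp: set_pmf_iff indicator_def)
  have i: "integrable (measure_pmf q) (indicator (set_pmf p) :: _ \<Rightarrow> real)"
    by (rule measure_pmf.integrable_const_bound[where B = 1]) (auto simp: indicator_def)
  then show 1: "integrable (measure_pmf p) (\<lambda>v. pmf q v / pmf p v)"
    by (simp only: summable_on_pmf_iff[symmetric] eq)
  show "measure_pmf.expectation p (\<lambda>v. pmf q v / pmf p v) = measure_pmf.prob q (set_pmf p)"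
    using infsum_pmf_eq[OF 1] infsum_pmf_eq[OF i] by (simp only: eq) simp
qed

text \<open>\<open>- ln (p / q) = ln (q / p) \<le> q / p - 1\<close>, and \<open>q / p\<close> is
  integrable under \<open>p\<close>. The bound holds for every pair of pmfs and is the starting
  point of the later integrability arguments.\<close>

lemma integrable_neg_part_lr: "integrable (measure_pmf p) (\<lambda>v. max 0 (- lr p q v))"
proof (rule integrable_pmf_bound[OF integrable_ratio_pmf(1)[of p q]])
  fix v assume "v \<in> set_pmf p"
  then have p: "pmf p v > 0"
    by (simp add: pmf_positive)
  show "\<bar>max 0 (- lr p q v)\<bar> \<le> pmf q v / pmf p v"
  \<comment> \<open>Where \<open>q\<close> vanishes, division by zero and \<open>ln 0\<close> both
    give 0, so the bound is trivial.\<close>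
  proof (cases "pmf q v = 0")
    case False
    then have q: "pmf q v > 0"
      by (simp add: order_less_le)
    then have "- lr p q v = ln (pmf q v / pmf p v)"
      using p by (simp add: lr_def ln_div)
    also have "\<dots> \<le> pmf q v / pmf p v - 1"
      using p q by (intro ln_le_minus_one) simp
    finally show ?thesis
      using p q by (auto simp: max_def)
  qed (simp add: lr_def)
qed

lemma lr_ge:
  assumes "pmf p v > 0" "pmf q v > 0"
  shows "lr p q v \<ge> 1 - pmf q v / pmf p v"
    and "lr p q v = 1 - pmf q v / pmf p v \<Longrightarrow> pmf p v = pmf q v"
proof -
  have eq: "lr p q v = - ln (pmf q v / pmf p v)"
    using assms by (simp add: lr_def ln_div)
  show "lr p q v \<ge> 1 - pmf q v / pmf p v"
    using ln_le_minus_one[of "pmf q v / pmf p v"] assms eq by simp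
  assume "lr p q v = 1 - pmf q v / pmf p v"
  then have "pmf q v / pmf p v = 1"
    using assms eq by (intro ln_eq_minus_one) auto
  then show "pmf p v = pmf q v"
    by simp
qed

text \<open>Gibbs' inequality. The mean of \<open>lr\<close> is the mean of its excess
  \<open>?g\<close> over the tangent bound plus the mass of \<open>q\<close> off the support of
  \<open>p\<close>, both nonnegative. If the sum vanishes, the pmfs agree on the support of
  \<open>p\<close> and \<open>q\<close> has no mass elsewhere.\<close>

lemma integral_lr:
  assumes sub: "set_pmf p \<subseteq> set_pmf q" and int: "integrable (measure_pmf p) (lr p q)"
  shows "0 \<le> measure_pmf.expectation p (lr p q)"
    and "measure_pmf.expectation p (lr p q) = 0 \<Longrightarrow> p = q"
proof -
  let ?r = "\<lambda>v. pmf q v / pmf p v" and ?g = "\<lambda>v. lr p q v - (1 - pmf q v / pmf p v)"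
  have pos: "pmf p v > 0" "pmf q v > 0" if "v \<in> set_pmf p" for v
    using that sub by (auto simp: pmf_positive)
  have i: "integrable (measure_pmf p) ?g"
    using int integrable_ratio_pmf(1)[of p q] by simp
  have g: "0 \<le> ?g v" if "v \<in> set_pmf p" for v
    using lr_ge[OF pos[OF that]] by simp
  have E: "measure_pmf.expectation p ?g
      = measure_pmf.expectation p (lr p q) - (1 - measure_pmf.prob q (set_pmf p))"
    using int integrable_ratio_pmf[of p q] by simp
  have le: "measure_pmf.prob q (set_pmf p) \<le> 1"
    by (rule measure_pmf.prob_le_1)
  have "0 \<le> measure_pmf.expectation p ?g"
    by (rule integral_pmf_nonneg) (rule g)
  then show "0 \<le> measure_pmf.expectation p (lr p q)"
    using E le by linarith
  assume "measure_pmf.expectation p (lr p q) = 0"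
  with E le \<open>0 \<le> measure_pmf.expectation p ?g\<close>
  have 0: "measure_pmf.expectation p ?g = 0" and 1: "measure_pmf.prob q (set_pmf p) = 1"
    by linarith+
  have "AE v in measure_pmf p. ?g v = 0"
    using 0 integral_nonneg_eq_0_iff_AE[OF i] g by (auto simp: AE_measure_pmf_iff)
  then have eq: "pmf p v = pmf q v" if "v \<in> set_pmf p" for v
    using lr_ge(2)[OF pos[OF that]] that by (auto simp: AE_measure_pmf_iff)
  have "set_pmf q \<subseteq> set_pmf p"
    using 1 by (subst (asm) measure_pmf.prob_eq_1) (auto simp: AE_measure_pmf_iff)
  then have "pmf p v = pmf q v" for v
    using eq[of v] by (cases "v \<in> set_pmf p") (auto simp: set_pmf_iff)
  then show "p = q"
    by (rule pmf_eqI)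
qed

section \<open>Kernels over a pmf and the chain rule for the divergence\<close>

definition pair_kernel :: "'a pmf \<Rightarrow> ('a \<Rightarrow> 'b pmf) \<Rightarrow> ('a \<times> 'b) pmf" where
  "pair_kernel p f = bind_pmf p (\<lambda>a. map_pmf (Pair a) (f a))"

lemma pmf_pair_kernel: "pmf (pair_kernel p f) (a, b) = pmf p a * pmf (f a) b"
  unfolding pair_kernel_def by (rule pmf_bind_Pair)

lemma set_pair_kernel: "set_pmf (pair_kernel p f) = Sigma (set_pmf p) (\<lambda>a. set_pmf (f a))"
  by (auto simp: pair_kernel_def)

lemma map_pmf_fst_pair_kernel: "map_pmf fst (pair_kernel p f) = p"
  by (simp add: pair_kernel_def map_bind_pmf pmf.map_comp o_def bind_return_pmf')

lemma bind_pair_kernel: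
  "bind_pmf (pair_kernel p f) h = bind_pmf p (\<lambda>a. bind_pmf (f a) (\<lambda>b. h (a, b)))"
  by (simp add: pair_kernel_def bind_assoc_pmf bind_map_pmf)

lemma integrable_pair_kernel_fst:
  fixes h :: "'a \<Rightarrow> real"
  shows "integrable (measure_pmf (pair_kernel p f)) (\<lambda>(a, b). h a) \<longleftrightarrow> integrable (measure_pmf p) h"
  using integrable_map_pmf_eq[where f = fst and p = "pair_kernel p f" and g = h]
  by (simp add: map_pmf_fst_pair_kernel case_prod_unfold)

lemma integral_pair_kernel_fst:
  fixes h :: "'a \<Rightarrow> real"
  shows "measure_pmf.expectation (pair_kernel p f) (\<lambda>(a, b). h a) = measure_pmf.expectation p h"
  using integral_map_pmf[where g = fst and p = "pair_kernel p f" and f = h]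
  by (simp add: map_pmf_fst_pair_kernel case_prod_unfold)

lemma lr_pair_kernel_same:
  assumes "a \<in> set_pmf p"
  shows "lr (pair_kernel p f) (pair_kernel p g) (a, b) = lr (f a) (g a) b"
  using assms by (simp add: lr_def pmf_pair_kernel set_pmf_iff)

text \<open>The conditional ratio is the ratio of two joint pmfs with the same first marginal,
  because \<open>pmf p a\<close> cancels on the support; so the general bound applies.\<close>

lemma integrable_pair_kernel_neg_part_lr:
  "integrable (measure_pmf (pair_kernel p f)) (\<lambda>(a, b). max 0 (- lr (f a) (g a) b))"
proof -
  have "integrable (measure_pmf (pair_kernel p f))
      (\<lambda>v. max 0 (- lr (pair_kernel p f) (pair_kernel p g) v))"
    by (rule integrable_neg_part_lr)
  then show ?thesis
    by (subst integrable_pmf_cong[where g = "\<lambda>v. max 0 (- lr (pair_kernel p f) (pair_kernel p g) v)"])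
      (auto simp: set_pair_kernel lr_pair_kernel_same)
qed

lemma integral_pair_kernel_lr:
  assumes sub: "\<And>a. a \<in> set_pmf p \<Longrightarrow> set_pmf (f a) \<subseteq> set_pmf (g a)"
    and int: "integrable (measure_pmf (pair_kernel p f)) (\<lambda>(a, b). lr (f a) (g a) b)"
  shows "0 \<le> measure_pmf.expectation (pair_kernel p f) (\<lambda>(a, b). lr (f a) (g a) b)"
    and "measure_pmf.expectation (pair_kernel p f) (\<lambda>(a, b). lr (f a) (g a) b) = 0
      \<Longrightarrow> a \<in> set_pmf p \<Longrightarrow> f a = g a"
proof -
  let ?P = "pair_kernel p f" and ?Q = "pair_kernel p g"
  have s: "set_pmf ?P \<subseteq> set_pmf ?Q"
    using sub by (auto simp: set_pair_kernel)
  have eq: "lr ?P ?Q v = (case v of (a, b) \<Rightarrow> lr (f a) (g a) b)" if "v \<in> set_pmf ?P" for v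
    using that by (auto simp: set_pair_kernel lr_pair_kernel_same)
  have i: "integrable (measure_pmf ?P) (lr ?P ?Q)"
    using int by (subst integrable_pmf_cong[OF eq])
  have E: "measure_pmf.expectation ?P (lr ?P ?Q)
      = measure_pmf.expectation ?P (\<lambda>(a, b). lr (f a) (g a) b)"
    by (rule integral_pmf_cong) (rule eq)
  show "0 \<le> measure_pmf.expectation ?P (\<lambda>(a, b). lr (f a) (g a) b)"
    using integral_lr(1)[OF s i] E by simp
  assume "measure_pmf.expectation ?P (\<lambda>(a, b). lr (f a) (g a) b) = 0" and a: "a \<in> set_pmf p"
  then have "?P = ?Q"
    using integral_lr(2)[OF s i] E by simp
  then have "pmf p a * pmf (f a) b = pmf p a * pmf (g a) b" for b
    by (metis pmf_pair_kernel)
  then show "f a = g a"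
    using a by (intro pmf_eqI) (simp add: set_pmf_iff)
qed

text \<open>The joint log-ratio is the sum of the marginal and the conditional one. Both have
  integrable negative parts, so the sum is integrable exactly when both summands are, which makes
  finiteness an equivalence.\<close>

lemma kl_pair_kernel_finite_iff:
  "kl (pair_kernel p f) (pair_kernel q g) \<noteq> \<infinity> \<longleftrightarrow>
    kl p q \<noteq> \<infinity> \<and> (\<forall>a\<in>set_pmf p. set_pmf (f a) \<subseteq> set_pmf (g a)) \<and>
    integrable (measure_pmf (pair_kernel p f)) (\<lambda>(a, b). lr (f a) (g a) b)" (is "?l \<longleftrightarrow> ?r")
  and kl_pair_kernel:
  "kl (pair_kernel p f) (pair_kernel q g) \<noteq> \<infinity> \<Longrightarrow>
    kl (pair_kernel p f) (pair_kernel q g) = kl p q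
      + ereal (measure_pmf.expectation (pair_kernel p f) (\<lambda>(a, b). lr (f a) (g a) b))"
proof -
  let ?P = "pair_kernel p f" and ?Q = "pair_kernel q g"
  \<comment> \<open>A conditional pmf has nonempty support, so inclusion of the joint supports
    yields inclusion of the marginal ones.\<close>
  have s: "set_pmf ?P \<subseteq> set_pmf ?Q \<longleftrightarrow>
      set_pmf p \<subseteq> set_pmf q \<and> (\<forall>a\<in>set_pmf p. set_pmf (f a) \<subseteq> set_pmf (g a))"
    using set_pmf_not_empty by (fastforce simp: set_pair_kernel)
  have *: "lr ?P ?Q v = (case v of (a, b) \<Rightarrow> lr p q a) + (case v of (a, b) \<Rightarrow> lr (f a) (g a) b)"
    if sub: "set_pmf ?P \<subseteq> set_pmf ?Q" and v: "v \<in> set_pmf ?P" for v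
  proof -
    obtain a b where ab: "v = (a, b)"
      by force
    have "v \<in> set_pmf ?Q"
      using sub v by blast
    then have "pmf p a > 0" "pmf (f a) b > 0" "pmf q a > 0" "pmf (g a) b > 0"
      using v ab by (auto simp: set_pair_kernel pmf_positive)
    then show ?thesis
      by (simp add: ab lr_def pmf_pair_kernel ln_div ln_mult)
  qed
  have i: "integrable (measure_pmf ?P) (lr ?P ?Q) \<longleftrightarrow>
      integrable (measure_pmf p) (lr p q) \<and> integrable (measure_pmf ?P) (\<lambda>(a, b). lr (f a) (g a) b)"
    if sub: "set_pmf ?P \<subseteq> set_pmf ?Q"
  proof
    assume "integrable (measure_pmf ?P) (lr ?P ?Q)"
    then have sum: "integrable (measure_pmf ?P)
        (\<lambda>v. (case v of (a, b) \<Rightarrow> lr p q a) + (case v of (a, b) \<Rightarrow> lr (f a) (g a) b))"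
      by (subst (asm) integrable_pmf_cong[OF *[OF sub]])
    have n1: "integrable (measure_pmf ?P) (\<lambda>v. max 0 (- (case v of (a, b) \<Rightarrow> lr p q a)))"
      using integrable_pair_kernel_fst[of p f "\<lambda>a. max 0 (- lr p q a)"] integrable_neg_part_lr[of p q]
      by (simp add: case_prod_unfold)
    have n2: "integrable (measure_pmf ?P) (\<lambda>v. max 0 (- (case v of (a, b) \<Rightarrow> lr (f a) (g a) b)))"
      using integrable_pair_kernel_neg_part_lr[of p f g] by (simp add: case_prod_unfold)
    from integrable_add_lower_bounded[OF sum n1 n2]
    show "integrable (measure_pmf p) (lr p q) \<and>
        integrable (measure_pmf ?P) (\<lambda>(a, b). lr (f a) (g a) b)"
      by (simp add: integrable_pair_kernel_fst)
  next
    assume "integrable (measure_pmf p) (lr p q) \<and>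
        integrable (measure_pmf ?P) (\<lambda>(a, b). lr (f a) (g a) b)"
    then show "integrable (measure_pmf ?P) (lr ?P ?Q)"
      by (subst integrable_pmf_cong[OF *[OF sub]])
        (auto intro!: Bochner_Integration.integrable_add simp: integrable_pair_kernel_fst)
  qed
  show iff: "?l \<longleftrightarrow> ?r"
    unfolding kl_finite_iff using s i by blast
  assume l: ?l
  then have sub: "set_pmf ?P \<subseteq> set_pmf ?Q"
    by (simp add: kl_finite_iff)
  have "measure_pmf.expectation ?P (lr ?P ?Q) = measure_pmf.expectation ?P
      (\<lambda>v. (case v of (a, b) \<Rightarrow> lr p q a) + (case v of (a, b) \<Rightarrow> lr (f a) (g a) b))"
    by (rule integral_pmf_cong) (rule *[OF sub])
  also have "\<dots> = measure_pmf.expectation ?P (\<lambda>(a, b). lr p q a)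
      + measure_pmf.expectation ?P (\<lambda>(a, b). lr (f a) (g a) b)"
    using l iff by (intro Bochner_Integration.integral_add)
      (auto simp: integrable_pair_kernel_fst kl_finite_iff)
  finally show "kl ?P ?Q = kl p q
      + ereal (measure_pmf.expectation ?P (\<lambda>(a, b). lr (f a) (g a) b))"
    using l iff by (simp add: kl_eq integral_pair_kernel_fst)
qed

text \<open>Injectivity is asked only on the two supports: the map that builds trajectories from
  pairs is injective only on extensional functions.\<close>

lemma kl_map_pmf_inj:
  assumes inj: "inj_on h (set_pmf p \<union> set_pmf q)"
  shows "kl (map_pmf h p) (map_pmf h q) = kl p q"
proof -
  have pm: "pmf (map_pmf h p) (h v) = pmf p v" "pmf (map_pmf h q) (h v) = pmf q v"
    if v: "v \<in> set_pmf p \<union> set_pmf q" for v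
  proof -
    have "pmf (map_pmf h r) (h v) = pmf r v" if r: "set_pmf r \<subseteq> set_pmf p \<union> set_pmf q" for r
    proof -
      have "measure_pmf.prob r (h -` {h v}) = measure_pmf.prob r {v}"
        by (rule measure_pmf.finite_measure_eq_AE)
          (use r v inj in \<open>auto simp: AE_measure_pmf_iff inj_on_def\<close>)
      then show ?thesis
        by (simp add: pmf_map measure_pmf_single)
    qed
    then show "pmf (map_pmf h p) (h v) = pmf p v" "pmf (map_pmf h q) (h v) = pmf q v"
      by auto
  qed
  have s: "set_pmf (map_pmf h p) \<subseteq> set_pmf (map_pmf h q) \<longleftrightarrow> set_pmf p \<subseteq> set_pmf q"
    using inj_on_image_subset_iff[OF inj, of "set_pmf p" "set_pmf q"] by simp
  have eq: "lr (map_pmf h p) (map_pmf h q) (h v) = lr p q v" if "v \<in> set_pmf p" for v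
    using that pm by (simp add: lr_def)
  have i: "integrable (measure_pmf (map_pmf h p)) (lr (map_pmf h p) (map_pmf h q))
      \<longleftrightarrow> integrable (measure_pmf p) (lr p q)"
    by (simp add: integrable_pmf_cong[OF eq])
  have E: "measure_pmf.expectation (map_pmf h p) (lr (map_pmf h p) (map_pmf h q))
      = measure_pmf.expectation p (lr p q)"
    by (simp add: integral_pmf_cong[OF eq])
  show ?thesis
  proof (cases "kl p q = \<infinity>")
    case True
    then have "kl (map_pmf h p) (map_pmf h q) = \<infinity>"
      using kl_finite_iff[of p q] kl_finite_iff[of "map_pmf h p" "map_pmf h q"] s i by blast
    with True show ?thesis by simp
  next
    case False
    then have "kl (map_pmf h p) (map_pmf h q) \<noteq> \<infinity>"
      using kl_finite_iff[of p q] kl_finite_iff[of "map_pmf h p" "map_pmf h q"] s i by blast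
    with False show ?thesis by (simp add: kl_eq E del: integral_map_pmf)
  qed
qed

lemma kl_self: "kl p p = 0"
proof -
  have "(\<lambda>v. pmf p v * ln (pmf p v / pmf p v)) = (\<lambda>_. 0)"
    by (rule ext) simp
  then show ?thesis
    by (simp only: kl_def) simp
qed

text \<open>Integrating the conditional ratio over the kernel first gives the conditional
  divergence. The way back from the averaged to the joint integral is the converse of Fubini for an
  integrable negative part.\<close>

lemma integrable_pair_kernel_lr_iff:
  assumes fin: "\<And>a. a \<in> set_pmf p \<Longrightarrow> kl (f a) (g a) \<noteq> \<infinity>"
  shows "integrable (measure_pmf (pair_kernel p f)) (\<lambda>(a, b). lr (f a) (g a) b)
    \<longleftrightarrow> integrable (measure_pmf p) (\<lambda>a. real_of_ereal (kl (f a) (g a)))" (is "?l \<longleftrightarrow> ?r")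
  and integral_pair_kernel_lr_eq:
  "integrable (measure_pmf (pair_kernel p f)) (\<lambda>(a, b). lr (f a) (g a) b) \<Longrightarrow>
    measure_pmf.expectation (pair_kernel p f) (\<lambda>(a, b). lr (f a) (g a) b)
    = measure_pmf.expectation p (\<lambda>a. real_of_ereal (kl (f a) (g a)))"
proof -
  have E: "measure_pmf.expectation (map_pmf (Pair a) (f a)) (\<lambda>(a, b). lr (f a) (g a) b)
      = real_of_ereal (kl (f a) (g a))" if "a \<in> set_pmf p" for a
    using kl_eq[OF fin[OF that]] by simp
  have cong: "integrable (measure_pmf p)
      (\<lambda>a. measure_pmf.expectation (map_pmf (Pair a) (f a)) (\<lambda>(a, b). lr (f a) (g a) b))
    \<longleftrightarrow> ?r"
    by (rule integrable_pmf_cong) (rule E)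
  show "?l \<longleftrightarrow> ?r"
  proof
    assume ?l
    then show ?r
      using integrable_bind_pmfD(2)[of p "\<lambda>a. map_pmf (Pair a) (f a)" "\<lambda>(a, b). lr (f a) (g a) b"] cong
      unfolding pair_kernel_def by blast
  next
    assume ?r
    show ?l
      unfolding pair_kernel_def
    proof (rule integrable_bind_pmf_neg_part)
      show "integrable (measure_pmf (bind_pmf p (\<lambda>a. map_pmf (Pair a) (f a))))
          (\<lambda>y. max 0 (- (case y of (a, b) \<Rightarrow> lr (f a) (g a) b)))"
        using integrable_pair_kernel_neg_part_lr[of p f g]
        by (simp add: pair_kernel_def case_prod_unfold)
      show "integrable (measure_pmf (map_pmf (Pair a) (f a))) (\<lambda>(a, b). lr (f a) (g a) b)"
        if "a \<in> set_pmf p" for a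
        using fin[OF that] by (simp add: kl_finite_iff)
    qed (use \<open>?r\<close> cong in blast)
  qed
  assume ?l
  then show "measure_pmf.expectation (pair_kernel p f) (\<lambda>(a, b). lr (f a) (g a) b)
      = measure_pmf.expectation p (\<lambda>a. real_of_ereal (kl (f a) (g a)))"
    unfolding pair_kernel_def
    by (subst integrable_bind_pmfD(3)[of p "\<lambda>a. map_pmf (Pair a) (f a)"])
      (auto intro!: integral_pmf_cong simp: E simp del: integral_map_pmf)
qed

lemma kl_nonneg: "0 \<le> kl p q"
  using integral_lr(1)[of p q] kl_eq[of p q] kl_finite_iff[of p q] by (cases "kl p q = \<infinity>") auto

section \<open>Marginals and divergence of the joint pmf\<close>

lemma state_marginal_Suc_N:
  assumes "k \<le> N"
  shows "state_marginal p0 px pu (Suc N) k = state_marginal p0 px pu N k"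
proof -
  have "k \<noteq> Suc N"
    using assms by simp
  then show ?thesis
    by (simp add: state_marginal_def map_bind_pmf case_prod_unfold map_pmf_def[of _ "joint_pmf _ _ _ N"])
qed

lemma state_input_marginal_Suc_N:
  assumes "k \<le> N"
  shows "state_input_marginal p0 px pu (Suc N) k = state_input_marginal p0 px pu N k"
proof -
  have "k \<noteq> Suc N" "k - Suc 0 \<noteq> Suc N"
    using assms by simp_all
  then show ?thesis
    by (simp add: state_input_marginal_def map_bind_pmf case_prod_unfold
        map_pmf_def[of _ "joint_pmf _ _ _ N"])
qed

lemma state_marginal_0: "state_marginal p0 px pu N 0 = p0"
  by (induction N)
    (simp_all add: state_marginal_Suc_N, simp add: state_marginal_def pmf.map_comp o_def)

text \<open>Together with \<open>state_marginal_step\<close> this replaces trajectories by a Markov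
  recursion on marginals. The last stage is read off the definition; earlier ones do not depend on
  the horizon.\<close>

lemma state_input_marginal_eq:
  assumes "k \<in> {1..N}"
  shows "state_input_marginal p0 px pu N k = pair_kernel (state_marginal p0 px pu N (k - 1)) (pu k)"
  using assms
proof (induction N)
  case (Suc N)
  show ?case
  proof (cases "k = Suc N")
    case True
    have "state_input_marginal p0 px pu (Suc N) (Suc N)
        = pair_kernel (state_marginal p0 px pu N N) (pu (Suc N))"
      by (simp add: state_input_marginal_def state_marginal_def pair_kernel_def map_bind_pmf
          bind_map_pmf case_prod_unfold map_pmf_def[of "Pair _"])
    then show ?thesis
      by (simp add: True state_marginal_Suc_N)
  next
    case False
    then have k: "k \<in> {1..N}" "k - 1 \<le> N"
      using Suc.prems by auto
    then show ?thesis
      using Suc.IH by (simp add: state_input_marginal_Suc_N state_marginal_Suc_N[OF k(2), simplified])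
  qed
qed simp

lemma state_marginal_step:
  assumes "k \<in> {1..N}"
  shows "state_marginal p0 px pu N k
    = bind_pmf (state_input_marginal p0 px pu N k) (\<lambda>(x, u). px k u x)"
  using assms
proof (induction N)
  case (Suc N)
  show ?case
  proof (cases "k = Suc N")
    case True
    have "state_marginal p0 px pu (Suc N) (Suc N) = bind_pmf
        (pair_kernel (state_marginal p0 px pu N N) (pu (Suc N))) (\<lambda>(x, u). px (Suc N) u x)"
      by (simp add: state_marginal_def bind_pair_kernel map_bind_pmf bind_map_pmf case_prod_unfold
          bind_return_pmf')
    then show ?thesis
      by (simp add: True state_marginal_Suc_N state_input_marginal_eq)
  qed (use Suc in \<open>simp add: state_marginal_Suc_N state_input_marginal_Suc_N\<close>)
qed simp

section \<open>The chain rule along trajectories\<close>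

lemma map_pmf_pair_kernel:
  "map_pmf (\<lambda>(t, u). (g t, u)) (pair_kernel p (\<lambda>t. f (g t))) = pair_kernel (map_pmf g p) f"
  by (simp add: pair_kernel_def map_bind_pmf bind_map_pmf pmf.map_comp o_def)

text \<open>The argument is nested in sampling order: past, input, state. \<open>joint_pmf\<close>
  thereby becomes the image of two iterated kernels, to which the chain rule applies.\<close>

definition extend_trajectory ::
  "nat \<Rightarrow> (((nat \<Rightarrow> 'x) \<times> (nat \<Rightarrow> 'u)) \<times> 'u) \<times> 'x \<Rightarrow> (nat \<Rightarrow> 'x) \<times> (nat \<Rightarrow> 'u)" where
  "extend_trajectory n = (\<lambda>((t, u), x). ((fst t)(Suc n := x), (snd t)(Suc n := u)))"

lemma joint_pmf_Suc_pair_kernel: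
  "joint_pmf p0 px pu (Suc n) = map_pmf (extend_trajectory n)
     (pair_kernel (pair_kernel (joint_pmf p0 px pu n) (\<lambda>t. pu (Suc n) (fst t n)))
       (\<lambda>(t, u). px (Suc n) u (fst t n)))"
  by (simp add: pair_kernel_def extend_trajectory_def map_bind_pmf bind_map_pmf bind_assoc_pmf
      map_pmf_def bind_return_pmf case_prod_unfold)

lemma inj_on_extend_trajectory:
  "inj_on (extend_trajectory n)
     ((({xs. xs \<in> extensional {0..n}} \<times> {us. us \<in> extensional {1..n}}) \<times> UNIV) \<times> UNIV)"
proof (rule inj_onI, clarsimp simp: extend_trajectory_def)
  fix xs xs' :: "nat \<Rightarrow> 'x" and us us' :: "nat \<Rightarrow> 'u" and u u' x x'
  assume ext: "xs \<in> extensional {0..n}" "xs' \<in> extensional {0..n}"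
      "us \<in> extensional {Suc 0..n}" "us' \<in> extensional {Suc 0..n}"
    and eq: "xs(Suc n := x) = xs'(Suc n := x')" "us(Suc n := u) = us'(Suc n := u')"
  have "xs i = xs' i" for i
    using fun_cong[OF eq(1), of i] ext by (cases "i = Suc n") (auto simp: extensional_def)
  moreover have "us i = us' i" for i
    using fun_cong[OF eq(2), of i] ext by (cases "i = Suc n") (auto simp: extensional_def)
  ultimately show "xs = xs' \<and> us = us' \<and> u = u' \<and> x = x'"
    using fun_cong[OF eq(1), of "Suc n"] fun_cong[OF eq(2), of "Suc n"] by (auto simp: fun_eq_iff)
qed

text \<open>Two applications of the chain rule: the input given the past, then the new state given
  the past and the input. The conditional terms depend on the past only through its last state, so
  they are integrated over the state-input marginal \<open>M\<close>.\<close>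

lemma kl_joint_pmf_Suc:
  fixes px qx :: "nat \<Rightarrow> 'u \<Rightarrow> 'x \<Rightarrow> 'x pmf" and pu qu :: "nat \<Rightarrow> 'x \<Rightarrow> 'u pmf"
    and p0 q0 :: "'x pmf"
  assumes fin: "\<And>x u. (x, u) \<in> set_pmf (state_input_marginal p0 px pu (Suc n) (Suc n)) \<Longrightarrow>
      kl (px (Suc n) u x) (qx (Suc n) u x) \<noteq> \<infinity>"
  defines "J \<equiv> joint_pmf p0 px pu" and "Q \<equiv> joint_pmf q0 qx qu"
    and "M \<equiv> state_input_marginal p0 px pu (Suc n) (Suc n)"
    and "L \<equiv> \<lambda>(x, u). lr (pu (Suc n) x) (qu (Suc n) x) u"
    and "D \<equiv> \<lambda>(x, u). real_of_ereal (kl (px (Suc n) u x) (qx (Suc n) u x))"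
  shows "kl (J (Suc n)) (Q (Suc n)) \<noteq> \<infinity> \<longleftrightarrow> kl (J n) (Q n) \<noteq> \<infinity> \<and>
      (\<forall>x\<in>set_pmf (state_marginal p0 px pu n n). set_pmf (pu (Suc n) x) \<subseteq> set_pmf (qu (Suc n) x)) \<and>
      integrable (measure_pmf M) L \<and> integrable (measure_pmf M) D" (is "?l \<longleftrightarrow> ?r")
    and "kl (J (Suc n)) (Q (Suc n)) \<noteq> \<infinity> \<Longrightarrow> kl (J (Suc n)) (Q (Suc n))
      = kl (J n) (Q n) + ereal (measure_pmf.expectation M L + measure_pmf.expectation M D)"
proof -
  define P1 where "P1 = pair_kernel (J n) (\<lambda>t. pu (Suc n) (fst t n))"
  define Q1 where "Q1 = pair_kernel (Q n) (\<lambda>t. qu (Suc n) (fst t n))"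
  define P2 where "P2 = pair_kernel P1 (\<lambda>(t, u). px (Suc n) u (fst t n))"
  define Q2 where "Q2 = pair_kernel Q1 (\<lambda>(t, u). qx (Suc n) u (fst t n))"
  let ?g = "\<lambda>(t, u). (fst t n, u)"
  have "map_pmf ?g P1 = pair_kernel (map_pmf (\<lambda>t. fst t n) (J n)) (pu (Suc n))"
    unfolding P1_def by (rule map_pmf_pair_kernel)
  also have "\<dots> = M"
    by (simp add: M_def state_input_marginal_eq state_marginal_Suc_N)
      (simp add: state_marginal_def J_def case_prod_unfold)
  finally have M: "map_pmf ?g P1 = M" .
  have ext: "set_pmf (pair_kernel (pair_kernel (joint_pmf p px pu n) f) g) \<subseteq>
      ((({xs. xs \<in> extensional {0..n}} \<times> {us. us \<in> extensional {1..n}}) \<times> UNIV) \<times> UNIV)"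
    for p and px :: "nat \<Rightarrow> 'u \<Rightarrow> 'x \<Rightarrow> 'x pmf" and pu f and g :: "_ \<Rightarrow> 'x pmf"
    using set_joint_pmf_extensional[of _ p px pu n] by (fastforce simp: set_pair_kernel)
  have "kl (J (Suc n)) (Q (Suc n)) = kl (map_pmf (extend_trajectory n) P2) (map_pmf (extend_trajectory n) Q2)"
    by (simp only: J_def Q_def P2_def Q2_def P1_def Q1_def joint_pmf_Suc_pair_kernel)
  also have "\<dots> = kl P2 Q2"
    unfolding P2_def Q2_def P1_def Q1_def J_def Q_def
    by (rule kl_map_pmf_inj[OF inj_on_subset[OF inj_on_extend_trajectory]]) (intro Un_least ext)
  finally have J: "kl (J (Suc n)) (Q (Suc n)) = kl P2 Q2" .
  have fin1: "kl (px (Suc n) u (fst t n)) (qx (Suc n) u (fst t n)) \<noteq> \<infinity>" if "(t, u) \<in> set_pmf P1" for t u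
  proof (rule fin)
    have "?g (t, u) \<in> ?g ` set_pmf P1"
      using that by (rule imageI)
    then show "(fst t n, u) \<in> set_pmf (state_input_marginal p0 px pu (Suc n) (Suc n))"
      using M by (metis (no_types, lifting) M_def case_prod_conv set_map_pmf)
  qed
  let ?f1 = "\<lambda>a. case a of (t, u) \<Rightarrow> px (Suc n) u (fst t n)"
    and ?f2 = "\<lambda>a. case a of (t, u) \<Rightarrow> qx (Suc n) u (fst t n)"
  have fin2: "kl (?f1 a) (?f2 a) \<noteq> \<infinity>" if "a \<in> set_pmf P1" for a
    using fin1 that by (cases a) simp
  have DD: "(\<lambda>a. real_of_ereal (kl (?f1 a) (?f2 a))) = (\<lambda>a. D (?g a))"
    by (auto simp: D_def)
  have iD: "integrable (measure_pmf P2) (\<lambda>(a, b). lr (?f1 a) (?f2 a) b) \<longleftrightarrow> integrable (measure_pmf M) D"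
    using integrable_pair_kernel_lr_iff[of P1 ?f1 ?f2, OF fin2]
    by (simp only: P2_def DD M[symmetric] integrable_map_pmf_eq)
  have LL: "(\<lambda>(t, u). lr (pu (Suc n) (fst t n)) (qu (Suc n) (fst t n)) u) = (\<lambda>a. L (?g a))"
    by (auto simp: L_def)
  have iL: "integrable (measure_pmf P1) (\<lambda>(t, u). lr (pu (Suc n) (fst t n)) (qu (Suc n) (fst t n)) u)
      \<longleftrightarrow> integrable (measure_pmf M) L"
    by (simp only: LL M[symmetric] integrable_map_pmf_eq)
  have sub: "(\<forall>t\<in>set_pmf (J n). set_pmf (pu (Suc n) (fst t n)) \<subseteq> set_pmf (qu (Suc n) (fst t n))) \<longleftrightarrow>
      (\<forall>x\<in>set_pmf (state_marginal p0 px pu n n). set_pmf (pu (Suc n) x) \<subseteq> set_pmf (qu (Suc n) x))"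
    by (simp add: state_marginal_def J_def case_prod_unfold)
  \<comment> \<open>Finiteness of the transition divergences already contains the inclusion of
    supports, so the second chain rule leaves only an integrability condition.\<close>
  have sub2: "\<forall>a\<in>set_pmf P1. set_pmf (?f1 a) \<subseteq> set_pmf (?f2 a)"
    using fin2 by (simp only: kl_finite_iff) simp
  have 2: "kl P2 Q2 \<noteq> \<infinity> \<longleftrightarrow> kl P1 Q1 \<noteq> \<infinity> \<and> integrable (measure_pmf M) D"
    using kl_pair_kernel_finite_iff[of P1 ?f1 Q1 ?f2] sub2 iD unfolding P2_def Q2_def by blast
  have 1: "kl P1 Q1 \<noteq> \<infinity> \<longleftrightarrow> kl (J n) (Q n) \<noteq> \<infinity> \<and>
      (\<forall>x\<in>set_pmf (state_marginal p0 px pu n n). set_pmf (pu (Suc n) x) \<subseteq> set_pmf (qu (Suc n) x)) \<and>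
      integrable (measure_pmf M) L"
    using kl_pair_kernel_finite_iff[of "J n" "\<lambda>t. pu (Suc n) (fst t n)" "Q n" "\<lambda>t. qu (Suc n) (fst t n)"]
    unfolding P1_def[symmetric] Q1_def[symmetric] sub iL .
  show "?l \<longleftrightarrow> ?r"
    by (simp only: J 2 1 conj_assoc)
  assume ?l
  then have f2: "kl P2 Q2 \<noteq> \<infinity>"
    by (simp only: J not_False_eq_True)
  then have f1: "kl P1 Q1 \<noteq> \<infinity>" and D: "integrable (measure_pmf M) D"
    using 2 by blast+
  have "measure_pmf.expectation P2 (\<lambda>(a, b). lr (?f1 a) (?f2 a) b)
      = measure_pmf.expectation P1 (\<lambda>a. real_of_ereal (kl (?f1 a) (?f2 a)))"
    unfolding P2_def
    using integral_pair_kernel_lr_eq[of P1 ?f1 ?f2, OF fin2] iD D unfolding P2_def by blast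
  also have "\<dots> = measure_pmf.expectation M D"
    by (simp only: DD M[symmetric] integral_map_pmf)
  finally have "kl P2 Q2 = kl P1 Q1 + ereal (measure_pmf.expectation M D)"
    using kl_pair_kernel[of P1 ?f1 Q1 ?f2] f2 unfolding P2_def Q2_def by simp
  moreover have "measure_pmf.expectation P1
      (\<lambda>(t, u). lr (pu (Suc n) (fst t n)) (qu (Suc n) (fst t n)) u) = measure_pmf.expectation M L"
    by (simp only: LL M[symmetric] integral_map_pmf)
  then have "kl P1 Q1 = kl (J n) (Q n) + ereal (measure_pmf.expectation M L)"
    using kl_pair_kernel[OF f1[unfolded P1_def Q1_def]] unfolding P1_def Q1_def by simp
  ultimately show "kl (J (Suc n)) (Q (Suc n))
      = kl (J n) (Q n) + ereal (measure_pmf.expectation M L + measure_pmf.expectation M D)"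
    unfolding J by (simp add: add.assoc)
qed

lemma kl_joint_pmf:
  fixes px qx :: "nat \<Rightarrow> 'u \<Rightarrow> 'x \<Rightarrow> 'x pmf"
  assumes "\<And>k x u. k \<in> {1..N} \<Longrightarrow> (x, u) \<in> set_pmf (state_input_marginal p0 px pu N k) \<Longrightarrow>
      kl (px k u x) (qx k u x) \<noteq> \<infinity>"
  shows "(kl (joint_pmf p0 px pu N) (joint_pmf q0 qx qu N) \<noteq> \<infinity> \<longleftrightarrow> kl p0 q0 \<noteq> \<infinity> \<and>
    (\<forall>k\<in>{1..N}.
      (\<forall>x\<in>set_pmf (state_marginal p0 px pu N (k - 1)). set_pmf (pu k x) \<subseteq> set_pmf (qu k x)) \<and>
      integrable (measure_pmf (state_input_marginal p0 px pu N k)) (\<lambda>(x, u). lr (pu k x) (qu k x) u) \<and>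
      integrable (measure_pmf (state_input_marginal p0 px pu N k))
        (\<lambda>(x, u). real_of_ereal (kl (px k u x) (qx k u x))))) \<and>
   (kl (joint_pmf p0 px pu N) (joint_pmf q0 qx qu N) \<noteq> \<infinity> \<longrightarrow>
    kl (joint_pmf p0 px pu N) (joint_pmf q0 qx qu N) = kl p0 q0 + ereal (\<Sum>k=1..N.
      measure_pmf.expectation (state_input_marginal p0 px pu N k) (\<lambda>(x, u). lr (pu k x) (qu k x) u)
      + measure_pmf.expectation (state_input_marginal p0 px pu N k)
          (\<lambda>(x, u). real_of_ereal (kl (px k u x) (qx k u x)))))"
  using assms
proof (induction N)
  case 0
  have "inj (\<lambda>x. ((\<lambda>_::nat. undefined)(0 := x), \<lambda>_::nat. undefined) :: (nat \<Rightarrow> 'x) \<times> (nat \<Rightarrow> 'u))"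
    by (auto simp: inj_on_def fun_eq_iff)
  then have "inj_on (\<lambda>x. ((\<lambda>_::nat. undefined)(0 := x), \<lambda>_::nat. undefined) :: (nat \<Rightarrow> 'x) \<times> (nat \<Rightarrow> 'u))
      (set_pmf p0 \<union> set_pmf q0)"
    by (rule inj_on_subset) simp
  then have "kl (joint_pmf p0 px pu 0) (joint_pmf q0 qx qu 0) = kl p0 q0"
    by (simp only: joint_pmf.simps kl_map_pmf_inj)
  then show ?case
    by simp
next
  case (Suc N)
  have IH: "kl (px k u x) (qx k u x) \<noteq> \<infinity>"
    if "k \<in> {1..N}" "(x, u) \<in> set_pmf (state_input_marginal p0 px pu N k)" for k x u
    using Suc.prems[of k x u] that by (simp add: state_input_marginal_Suc_N)
  have fin: "kl (px (Suc N) u x) (qx (Suc N) u x) \<noteq> \<infinity>"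
    if "(x, u) \<in> set_pmf (state_input_marginal p0 px pu (Suc N) (Suc N))" for x u
    using Suc.prems[of "Suc N"] that by simp
  have split: "(\<forall>k\<in>{1..Suc N}. P k) \<longleftrightarrow> (\<forall>k\<in>{1..N}. P k) \<and> P (Suc N)" for P
    by (simp add: atLeastAtMostSuc_conv conj_commute)
  note step = kl_joint_pmf_Suc[of p0 px pu N qx q0 qu, OF fin]
  have eqs: "(\<forall>k\<in>{1..N}. P k (state_marginal p0 px pu (Suc N) (k - 1)) (state_input_marginal p0 px pu (Suc N) k))
     \<longleftrightarrow> (\<forall>k\<in>{1..N}. P k (state_marginal p0 px pu N (k - 1)) (state_input_marginal p0 px pu N k))" for P
  proof (intro ball_cong refl)
    fix k assume "k \<in> {1..N}"
    then have "k - 1 \<le> N" "k \<le> N"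
      by auto
    then show "P k (state_marginal p0 px pu (Suc N) (k - 1)) (state_input_marginal p0 px pu (Suc N) k)
        = P k (state_marginal p0 px pu N (k - 1)) (state_input_marginal p0 px pu N k)"
      by (simp only: state_marginal_Suc_N state_input_marginal_Suc_N)
  qed
  have sums: "(\<Sum>k=1..N. f k (state_input_marginal p0 px pu (Suc N) k))
     = (\<Sum>k=1..N. f k (state_input_marginal p0 px pu N k))" for f :: "nat \<Rightarrow> ('x \<times> 'u) pmf \<Rightarrow> real"
    by (rule sum.cong) (simp_all add: state_input_marginal_Suc_N)
  have last: "state_marginal p0 px pu (Suc N) (Suc N - 1) = state_marginal p0 px pu N N"
    by (simp add: state_marginal_Suc_N)
  show ?case
    unfolding split last
    unfolding eqs[of "\<lambda>k \<nu> \<sigma>. (\<forall>x\<in>set_pmf \<nu>. set_pmf (pu k x) \<subseteq> set_pmf (qu k x)) \<and>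
      integrable (measure_pmf \<sigma>) (\<lambda>(x, u). lr (pu k x) (qu k x) u) \<and>
      integrable (measure_pmf \<sigma>) (\<lambda>(x, u). real_of_ereal (kl (px k u x) (qx k u x)))"]
    using Suc.IH[OF IH] step
      sums[of "\<lambda>k \<sigma>. measure_pmf.expectation \<sigma> (\<lambda>(x, u). lr (pu k x) (qu k x) u)
      + measure_pmf.expectation \<sigma> (\<lambda>(x, u). real_of_ereal (kl (px k u x) (qx k u x)))"]
    by (auto simp: add.assoc)
qed

text \<open>In \<open>ereal\<close>, infinity minus anything is infinity, so any other value bounds
  the positive part. The value may still be minus infinity, so nothing follows for the negative
  part.\<close>

lemma ext_expectation_finite:
  assumes "ext_expectation p h \<noteq> \<infinity>"
  shows "integrable (measure_pmf p) (\<lambda>v. max 0 (h v))"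
proof -
  have "(\<integral>\<^sup>+ v. ennreal (h v) \<partial>measure_pmf p) \<noteq> \<infinity>"
    using assms by (auto simp: ext_expectation_def)
  moreover have "(\<integral>\<^sup>+ v. ennreal (norm (max 0 (h v))) \<partial>measure_pmf p) = (\<integral>\<^sup>+ v. ennreal (h v) \<partial>measure_pmf p)"
    by (rule nn_integral_cong) (auto simp: max_def ennreal_neg)
  ultimately show ?thesis
    by (simp add: integrable_iff_bounded less_top)
qed

lemma ext_expectation_eq:
  assumes "integrable (measure_pmf p) h"
  shows "ext_expectation p h = ereal (measure_pmf.expectation p h)"
proof -
  have pos: "(\<integral>\<^sup>+ v. ennreal (f v) \<partial>measure_pmf p) = ennreal (measure_pmf.expectation p (\<lambda>v. max 0 (f v)))"
    if "integrable (measure_pmf p) f" for f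
  proof -
    have "(\<integral>\<^sup>+ v. ennreal (f v) \<partial>measure_pmf p) = (\<integral>\<^sup>+ v. ennreal (max 0 (f v)) \<partial>measure_pmf p)"
      by (rule nn_integral_cong) (auto simp: max_def ennreal_neg)
    also have "\<dots> = ennreal (measure_pmf.expectation p (\<lambda>v. max 0 (f v)))"
      using that by (intro nn_integral_eq_integral) auto
    finally show ?thesis .
  qed
  have "measure_pmf.expectation p h
      = measure_pmf.expectation p (\<lambda>v. max 0 (h v) - max 0 (- h v))"
    by (rule integral_pmf_cong) auto
  also have "\<dots> = measure_pmf.expectation p (\<lambda>v. max 0 (h v)) - measure_pmf.expectation p (\<lambda>v. max 0 (- h v))"
    using assms by (intro Bochner_Integration.integral_diff) auto
  finally show ?thesis
    using assms by (simp add: ext_expectation_def pos integral_pmf_nonneg)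
qed

section \<open>The control problem\<close>

text \<open>The hypotheses shared by the full problem and by its one-stage problems, which form a
  second interpretation with horizon 1. Integrability of the costs along the candidate and
  finiteness of the initial divergence enter later.\<close>

locale kl_control_problem =
  fixes N :: nat and X :: "'x set" and U :: "'u set"
    and p0 q0 :: "'x pmf"
    and px qx :: "nat \<Rightarrow> 'u \<Rightarrow> 'x \<Rightarrow> 'x pmf"
    and qu :: "nat \<Rightarrow> 'x \<Rightarrow> 'u pmf"
    and c :: "nat \<Rightarrow> 'x \<Rightarrow> real"
  assumes p0_sub: "set_pmf p0 \<subseteq> X"
    and px_sub: "\<And>k u x. k \<in> {1..N} \<Longrightarrow> u \<in> U \<Longrightarrow> x \<in> X \<Longrightarrow> set_pmf (px k u x) \<subseteq> X"
    and qu_policy: "qu \<in> policies N X U"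
    and kl_finite: "\<And>k u x. k \<in> {1..N} \<Longrightarrow> u \<in> U \<Longrightarrow> x \<in> X \<Longrightarrow> kl (px k u x) (qx k u x) \<noteq> \<infinity>"
    and c_sum: "\<And>k u x. k \<in> {1..N} \<Longrightarrow> u \<in> U \<Longrightarrow> x \<in> X \<Longrightarrow>
        integrable (measure_pmf (px k u x)) (c k)"
    and cbar_sum: "\<And>k u x. k \<in> {1..N} \<Longrightarrow> u \<in> U \<Longrightarrow> x \<in> X \<Longrightarrow>
        integrable (measure_pmf (px k u x)) (cbar N px qx qu c k)"
    and exp_sum: "\<And>k x. k \<in> {1..N} \<Longrightarrow> x \<in> X \<Longrightarrow>
        integrable (measure_pmf (qu k x)) (\<lambda>u. exp (- real_of_ereal (kl (px k u x) (qx k u x))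
          - measure_pmf.expectation (px k u x) (cbar N px qx qu c k)))"
begin

abbreviation "ch \<equiv> chat N px qx qu c"
abbreviation "opt \<equiv> opt_policy N px qx qu c"
abbreviation "xm \<equiv> \<lambda>pu. state_marginal p0 px pu N"
abbreviation "xum \<equiv> \<lambda>pu. state_input_marginal p0 px pu N"
abbreviation "J \<equiv> objective N p0 px q0 qx qu c"

definition state_kl :: "nat \<Rightarrow> 'x \<times> 'u \<Rightarrow> real" where
  "state_kl k = (\<lambda>(x, u). real_of_ereal (kl (px k u x) (qx k u x)))"

definition stage_cost :: "nat \<Rightarrow> 'x \<times> 'u \<Rightarrow> real" where
  "stage_cost k = (\<lambda>(x, u). measure_pmf.expectation (px k u x) (c k))"

definition next_value :: "nat \<Rightarrow> 'x \<times> 'u \<Rightarrow> real" where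
  "next_value k = (\<lambda>(x, u). measure_pmf.expectation (px k u x) (ch k))"

definition lr_ref :: "(nat \<Rightarrow> 'x \<Rightarrow> 'u pmf) \<Rightarrow> nat \<Rightarrow> 'x \<times> 'u \<Rightarrow> real" where
  "lr_ref pu k = (\<lambda>(x, u). lr (pu k x) (qu k x) u)"

definition lr_star :: "(nat \<Rightarrow> 'x \<Rightarrow> 'u pmf) \<Rightarrow> nat \<Rightarrow> 'x \<times> 'u \<Rightarrow> real" where
  "lr_star pu k = (\<lambda>(x, u). lr (pu k x) (opt k x) u)"

lemma state_kl_nonneg: "0 \<le> state_kl k xu"
  by (auto simp: state_kl_def kl_nonneg real_of_ereal_pos split: prod.split)

lemma chat_integrable:
  assumes "k \<in> {1..N}" "u \<in> U" "x \<in> X"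
  shows "integrable (measure_pmf (px k u x)) (ch k)"
    and "measure_pmf.expectation (px k u x) (cbar N px qx qu c k) = stage_cost k (x, u) - next_value k (x, u)"
proof -
  have eq: "ch k = (\<lambda>y. c k y - cbar N px qx qu c k y)"
    by (simp add: cbar_def)
  show i: "integrable (measure_pmf (px k u x)) (ch k)"
    by (subst eq) (intro Bochner_Integration.integrable_diff c_sum cbar_sum assms)
  show "measure_pmf.expectation (px k u x) (cbar N px qx qu c k) = stage_cost k (x, u) - next_value k (x, u)"
    using Bochner_Integration.integral_diff[OF c_sum[OF assms] i]
    by (simp add: stage_cost_def next_value_def cbar_def[abs_def])
qed

section \<open>Normalisation and support of the candidate policy\<close>

lemma set_qu: "k \<in> {1..N} \<Longrightarrow> x \<in> X \<Longrightarrow> set_pmf (qu k x) \<subseteq> U"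
  using qu_policy by (auto simp: policies_def)

text \<open>The partition function of stage \<open>k\<close>, indexed by the time of the input; its
  logarithm is \<open>chat\<close> at time \<open>k - 1\<close>.\<close>

definition Z :: "nat \<Rightarrow> 'x \<Rightarrow> real" where
  "Z k x = measure_pmf.expectation (qu k x) (\<lambda>u. exp (- real_of_ereal (kl (px k u x) (qx k u x))
          - measure_pmf.expectation (px k u x) (cbar N px qx qu c k)))"

text \<open>A strictly positive integrable function cannot have mean 0. Without
  \<open>exp_sum\<close> the expectation could be the default 0, and the candidate a division by
  zero.\<close>

lemma Z_pos:
  assumes "k \<in> {1..N}" "x \<in> X"
  shows "0 < Z k x"
proof -
  let ?f = "\<lambda>u. exp (- real_of_ereal (kl (px k u x) (qx k u x))
          - measure_pmf.expectation (px k u x) (cbar N px qx qu c k))"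
  have "0 \<le> Z k x"
    unfolding Z_def by (rule integral_pmf_nonneg) simp
  moreover have "Z k x \<noteq> 0"
  proof
    assume "Z k x = 0"
    then have "AE u in measure_pmf (qu k x). ?f u = 0"
      using integral_nonneg_eq_0_iff_AE[OF exp_sum[OF assms]] by (simp add: Z_def)
    then show False
      using set_pmf_not_empty[of "qu k x"] by (simp add: AE_measure_pmf_iff)
  qed
  ultimately show ?thesis
    by simp
qed

lemma chat_eq_ln_Z:
  assumes "k \<in> {1..N}"
  shows "ch (k - 1) x = ln (Z k x)"
proof -
  have k: "k - 1 < N" "Suc (k - 1) = k"
    using assms by auto
  show ?thesis
    using chat_rec[OF k(1), of px qx qu c x] by (simp only: k(2) Z_def)
qed

lemma pu_star_eq:
  assumes "k \<in> {1..N}" "x \<in> X"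
  shows "pu_star N px qx qu c k x u = pmf (qu k x) u
    * exp (- real_of_ereal (kl (px k u x) (qx k u x))
          - measure_pmf.expectation (px k u x) (cbar N px qx qu c k)) / Z k x"
proof -
  have eq: "pu_bar px qx qu k x v * exp (- measure_pmf.expectation (px k v x) (cbar N px qx qu c k))
      = pmf (qu k x) v * exp (- real_of_ereal (kl (px k v x) (qx k v x))
          - measure_pmf.expectation (px k v x) (cbar N px qx qu c k))" for v
    by (simp add: pu_bar_def exp_diff exp_minus field_simps)
  show ?thesis
    unfolding pu_star_def eq Z_def infsum_pmf_eq[OF exp_sum[OF assms]] ..
qed

text \<open>Discharges the condition under which \<open>embed_pmf\<close> is meaningful: summed over
  all inputs, the candidate is the mean of the exponential weight under \<open>qu k x\<close>,
  divided by \<open>Z k x\<close>.\<close>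

lemma pmf_opt:
  assumes "k \<in> {1..N}" "x \<in> X"
  shows "pmf (opt k x) u = pu_star N px qx qu c k x u"
  unfolding opt_policy_def
proof (rule pmf_embed_pmf)
  let ?f = "\<lambda>u. exp (- real_of_ereal (kl (px k u x) (qx k u x))
          - measure_pmf.expectation (px k u x) (cbar N px qx qu c k))"
  show "0 \<le> pu_star N px qx qu c k x u" for u
    using Z_pos[OF assms] by (simp add: pu_star_eq[OF assms])
  have "(\<integral>\<^sup>+ u. ennreal (pu_star N px qx qu c k x u) \<partial>count_space UNIV)
      = (\<integral>\<^sup>+ u. ennreal (pmf (qu k x) u) * ennreal (?f u / Z k x) \<partial>count_space UNIV)"
    by (rule nn_integral_cong) (simp add: pu_star_eq[OF assms] ennreal_mult'[symmetric])
  also have "\<dots> = (\<integral>\<^sup>+ u. ennreal (?f u / Z k x) \<partial>measure_pmf (qu k x))"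
    unfolding measure_pmf_eq_density[of "qu k x"] by (subst nn_integral_density) auto
  also have "\<dots> = ennreal (measure_pmf.expectation (qu k x) (\<lambda>u. ?f u / Z k x))"
    using Z_pos[OF assms] exp_sum[OF assms] by (intro nn_integral_eq_integral) auto
  also have "measure_pmf.expectation (qu k x) (\<lambda>u. ?f u / Z k x) = 1"
    using Z_pos[OF assms] by (simp add: Z_def)
  finally show "(\<integral>\<^sup>+ u. ennreal (pu_star N px qx qu c k x u) \<partial>count_space UNIV) = 1"
    by simp
qed

lemma set_opt:
  assumes "k \<in> {1..N}" "x \<in> X"
  shows "set_pmf (opt k x) = set_pmf (qu k x)"
  using Z_pos[OF assms] by (auto simp: set_pmf_eq pmf_opt[OF assms] pu_star_eq[OF assms])

lemma opt_in_policies: "opt \<in> policies N X U"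
  using set_opt set_qu by (auto simp: policies_def)

text \<open>Logarithms in \<open>pu_star_eq\<close>: the exponent gives the divergence and cost
  terms, the normaliser gives \<open>ch (k - 1)\<close>. The inclusion of supports makes all
  arguments of \<open>ln\<close> positive.\<close>

lemma lr_opt:
  assumes k: "k \<in> {1..N}" "x \<in> X" and sub: "set_pmf r \<subseteq> set_pmf (qu k x)" and u: "u \<in> set_pmf r"
  shows "lr r (opt k x) u
    = lr r (qu k x) u + state_kl k (x, u) + stage_cost k (x, u) - next_value k (x, u) + ch (k - 1) x"
proof -
  have q: "u \<in> set_pmf (qu k x)" and U: "u \<in> U"
    using sub u set_qu[OF k] by auto
  have pos: "pmf r u > 0" "pmf (qu k x) u > 0" "Z k x > 0"
    using q u Z_pos[OF k] by (auto simp: pmf_positive)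
  have "pmf (opt k x) u = pmf (qu k x) u * exp (- state_kl k (x, u) - (stage_cost k (x, u) - next_value k (x, u))) / Z k x"
    by (simp add: pmf_opt[OF k] pu_star_eq[OF k] chat_integrable(2)[OF k(1) U k(2)] state_kl_def)
  then show ?thesis
    unfolding lr_def chat_eq_ln_Z[OF k(1)] using pos by (simp add: ln_div ln_mult)
qed

text \<open>The hypotheses constrain the kernels only on \<open>X\<close> and \<open>U\<close>, so
  their use requires that a feasible policy never leaves these sets. States and inputs alternate in
  the induction.\<close>

lemma
  assumes pu: "pu \<in> policies N X U"
  shows state_reachable: "k \<le> N \<Longrightarrow> set_pmf (xm pu k) \<subseteq> X"
    and input_reachable: "k \<in> {1..N} \<Longrightarrow> set_pmf (xum pu k) \<subseteq> X \<times> U"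
proof -
  have *: "set_pmf (xum pu k) \<subseteq> X \<times> U" if "k \<in> {1..N}" "set_pmf (xm pu (k - 1)) \<subseteq> X" for k
    using that pu by (fastforce simp: state_input_marginal_eq set_pair_kernel policies_def)
  show X: "set_pmf (xm pu k) \<subseteq> X" if "k \<le> N" for k
    using that
  proof (induction k)
    case 0
    then show ?case by (simp add: state_marginal_0 p0_sub)
  next
    case (Suc k)
    have k: "Suc k \<in> {1..N}"
      using Suc.prems by simp
    have "set_pmf (xum pu (Suc k)) \<subseteq> X \<times> U"
      using * Suc k by simp
    then show ?case
      using px_sub[OF k] by (fastforce simp: state_marginal_step[OF k])
  qed
  show "set_pmf (xum pu k) \<subseteq> X \<times> U" if k: "k \<in> {1..N}"
    by (rule *[OF k X]) (use k in auto)
qed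

lemma lr_star_eq:
  assumes pu: "pu \<in> policies N X U" and k: "k \<in> {1..N}"
    and sub: "\<And>x. x \<in> set_pmf (xm pu (k - 1)) \<Longrightarrow> set_pmf (pu k x) \<subseteq> set_pmf (qu k x)"
    and xu: "xu \<in> set_pmf (xum pu k)"
  shows "lr_star pu k xu = lr_ref pu k xu + state_kl k xu + stage_cost k xu - next_value k xu + ch (k - 1) (fst xu)"
proof -
  obtain x u where eq: "xu = (x, u)"
    by force
  have "x \<in> set_pmf (xm pu (k - 1))" "u \<in> set_pmf (pu k x)" "x \<in> X"
    using xu input_reachable[OF pu k] by (auto simp: eq state_input_marginal_eq[OF k] set_pair_kernel)
  then show ?thesis
    using lr_opt[OF k, of x "pu k x" u] sub by (simp add: eq lr_star_def lr_ref_def)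
qed

section \<open>Passing integrability between consecutive marginals\<close>

lemma neg_parts_integrable:
  assumes "k \<in> {1..N}"
  shows "integrable (measure_pmf (xum pu k)) (\<lambda>xu. max 0 (- lr_ref pu k xu))"
    and "integrable (measure_pmf (xum pu k)) (\<lambda>xu. max 0 (- lr_star pu k xu))"
  using integrable_pair_kernel_neg_part_lr[of "xm pu (k - 1)" "pu k"]
  by (simp_all add: state_input_marginal_eq[OF assms] lr_ref_def lr_star_def case_prod_unfold)

lemma integrable_xum_fst:
  fixes h :: "'x \<Rightarrow> real"
  assumes "k \<in> {1..N}"
  shows "integrable (measure_pmf (xum pu k)) (\<lambda>xu. h (fst xu)) \<longleftrightarrow> integrable (measure_pmf (xm pu (k - 1))) h"
    and "measure_pmf.expectation (xum pu k) (\<lambda>xu. h (fst xu)) = measure_pmf.expectation (xm pu (k - 1)) h"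
  using integrable_pair_kernel_fst[of "xm pu (k - 1)" "pu k" h]
    integral_pair_kernel_fst[of "xm pu (k - 1)" "pu k" h]
  by (simp_all add: state_input_marginal_eq[OF assms] case_prod_unfold)

lemma chat_integrable_xum:
  assumes "pu \<in> policies N X U" "k \<in> {1..N}" "xu \<in> set_pmf (xum pu k)"
  shows "integrable (measure_pmf (case xu of (x, u) \<Rightarrow> px k u x)) (ch k)"
  using assms input_reachable[OF assms(1,2)] chat_integrable(1)[OF assms(2)] by (cases xu) auto

lemma next_value_alt: "next_value k = (\<lambda>xu. measure_pmf.expectation (case xu of (x, u) \<Rightarrow> px k u x) (ch k))"
  by (auto simp: next_value_def)

lemma next_value_pos_part:
  assumes "pu \<in> policies N X U" "k \<in> {1..N}"
    "integrable (measure_pmf (xm pu k)) (\<lambda>x. max 0 (ch k x))"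
  shows "integrable (measure_pmf (xum pu k)) (\<lambda>xu. max 0 (next_value k xu))"
  unfolding next_value_alt
  by (rule integrable_pos_part_conditional[OF _ chat_integrable_xum[OF assms(1,2)]])
    (use assms in \<open>simp_all add: state_marginal_step\<close>)

lemma next_value_neg_part:
  assumes "pu \<in> policies N X U" "k \<in> {1..N}"
    "integrable (measure_pmf (xm pu k)) (\<lambda>x. max 0 (- ch k x))"
  shows "integrable (measure_pmf (xum pu k)) (\<lambda>xu. max 0 (- next_value k xu))"
proof -
  have "integrable (measure_pmf (xum pu k))
      (\<lambda>xu. max 0 (measure_pmf.expectation (case xu of (x, u) \<Rightarrow> px k u x) (\<lambda>y. - ch k y)))"
    by (rule integrable_pos_part_conditional[where f = "\<lambda>y. - ch k y"])
      (use assms chat_integrable_xum[OF assms(1,2)] in \<open>simp_all add: state_marginal_step\<close>)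
  then show ?thesis
    by (simp add: next_value_alt)
qed

text \<open>The one-sided converse of Fubini carries integrability from the conditional means to
  \<open>ch k\<close> itself; one part has to be known beforehand.\<close>

lemma chat_step_pos:
  assumes "pu \<in> policies N X U" "k \<in> {1..N}" "integrable (measure_pmf (xum pu k)) (next_value k)"
    "integrable (measure_pmf (xm pu k)) (\<lambda>x. max 0 (ch k x))"
  shows "integrable (measure_pmf (xm pu k)) (ch k)"
  unfolding state_marginal_step[OF assms(2)]
  by (rule integrable_bind_pmf_pos_part)
    (use assms chat_integrable_xum[OF assms(1,2)] in \<open>simp_all add: state_marginal_step next_value_alt\<close>)

lemma chat_step_neg:
  assumes "pu \<in> policies N X U" "k \<in> {1..N}" "integrable (measure_pmf (xum pu k)) (next_value k)"
    "integrable (measure_pmf (xm pu k)) (\<lambda>x. max 0 (- ch k x))"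
  shows "integrable (measure_pmf (xm pu k)) (ch k)"
  unfolding state_marginal_step[OF assms(2)]
  by (rule integrable_bind_pmf_neg_part)
    (use assms chat_integrable_xum[OF assms(1,2)] in \<open>simp_all add: state_marginal_step next_value_alt\<close>)

lemma integral_next_value:
  assumes "pu \<in> policies N X U" "k \<in> {1..N}" "integrable (measure_pmf (xm pu k)) (ch k)"
  shows "measure_pmf.expectation (xum pu k) (next_value k) = measure_pmf.expectation (xm pu k) (ch k)"
  using integrable_bind_pmfD(3)[of "xum pu k" "\<lambda>(x, u). px k u x" "ch k"] assms(3)
  by (simp add: state_marginal_step[OF assms(2)] next_value_alt)

section \<open>Backward and forward inductions on the value functions\<close>

lemma chat_N: "ch N = (\<lambda>_. 0)"
  by (simp add: chat_terminal fun_eq_iff)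

text \<open>Domination is asked only at states of positive probability: elsewhere a policy has no
  influence on the trajectory.\<close>

definition dominated :: "(nat \<Rightarrow> 'x \<Rightarrow> 'u pmf) \<Rightarrow> bool" where
  "dominated pu \<longleftrightarrow> (\<forall>k\<in>{1..N}. \<forall>x\<in>set_pmf (xm pu (k - 1)). set_pmf (pu k x) \<subseteq> set_pmf (qu k x))"

lemma dominated_opt: "dominated opt"
proof -
  have "set_pmf (opt k x) \<subseteq> set_pmf (qu k x)" if "k \<in> {1..N}" "x \<in> set_pmf (xm opt (k - 1))" for k x
  proof -
    have "k - 1 \<le> N"
      using that by auto
    from state_reachable[OF opt_in_policies this] have "x \<in> X"
      using that by blast
    then show ?thesis
      using set_opt[OF that(1)] by simp
  qed
  then show ?thesis
    by (auto simp: dominated_def)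
qed

lemma lr_star_dominated:
  assumes "pu \<in> policies N X U" "dominated pu" "k \<in> {1..N}" "xu \<in> set_pmf (xum pu k)"
  shows "lr_star pu k xu = lr_ref pu k xu + state_kl k xu + stage_cost k xu - next_value k xu + ch (k - 1) (fst xu)"
  using lr_star_eq[OF assms(1,3) _ assms(4)] assms(2,3) by (auto simp: dominated_def)

lemma lr_star_opt: "k \<in> {1..N} \<Longrightarrow> xu \<in> set_pmf (xum opt k) \<Longrightarrow> lr_star opt k xu = 0"
  by (auto simp: lr_star_def lr_def state_input_marginal_eq set_pair_kernel set_pmf_iff split: prod.split)

text \<open>Along the candidate \<open>lr_star\<close> vanishes, so \<open>ch (k - 1)\<close> equals
  \<open>next_value - lr_ref - state_kl - stage_cost\<close>. Here \<open>- state_kl\<close> is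
  nonpositive, \<open>- lr_ref\<close> is bounded by an integrable negative part, and the induction
  hypothesis bounds \<open>next_value\<close>.\<close>

lemma chat_pos_part_opt:
  assumes cost: "\<And>k. k \<in> {1..N} \<Longrightarrow> integrable (measure_pmf (xum opt k)) (stage_cost k)"
    and "k \<le> N"
  shows "integrable (measure_pmf (xm opt k)) (\<lambda>x. max 0 (ch k x))"
  using \<open>k \<le> N\<close>
proof (induction k rule: inc_induct)
  case base
  show ?case by (simp add: chat_N)
next
  case (step n)
  have k: "Suc n \<in> {1..N}"
    using step.hyps by simp
  note e = next_value_pos_part[OF opt_in_policies k step.IH]
  have "integrable (measure_pmf (xum opt (Suc n))) (\<lambda>xu. max 0 (ch (Suc n - 1) (fst xu)))"
  proof (rule integrable_pmf_bound)
    show "integrable (measure_pmf (xum opt (Suc n))) (\<lambda>xu. max 0 (- lr_ref opt (Suc n) xu)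
        + \<bar>stage_cost (Suc n) xu\<bar> + max 0 (next_value (Suc n) xu))"
      by (intro Bochner_Integration.integrable_add integrable_abs e neg_parts_integrable[OF k] cost[OF k])
    show "\<bar>max 0 (ch (Suc n - 1) (fst xu))\<bar>
        \<le> max 0 (- lr_ref opt (Suc n) xu) + \<bar>stage_cost (Suc n) xu\<bar> + max 0 (next_value (Suc n) xu)"
      if xu: "xu \<in> set_pmf (xum opt (Suc n))" for xu
      using lr_star_dominated[OF opt_in_policies dominated_opt k xu] lr_star_opt[OF k xu] state_kl_nonneg[of "Suc n" xu]
      by linarith
  qed
  then show ?case
    using integrable_xum_fst(1)[OF k, of opt "\<lambda>x. max 0 (ch (Suc n - 1) x)"] by simp
qed

text \<open>What an objective other than infinity yields. Only the positive part of the stage cost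
  appears, since an expectation of minus infinity is not excluded at this point.\<close>

definition finite_terms :: "(nat \<Rightarrow> 'x \<Rightarrow> 'u pmf) \<Rightarrow> bool" where
  "finite_terms pu \<longleftrightarrow> dominated pu \<and> (\<forall>k\<in>{1..N}.
     integrable (measure_pmf (xum pu k)) (lr_ref pu k) \<and> integrable (measure_pmf (xum pu k)) (state_kl k) \<and>
     integrable (measure_pmf (xum pu k)) (\<lambda>xu. max 0 (stage_cost k xu)))"

text \<open>The stage identity gives \<open>- ch (k - 1)\<close> as
  \<open>lr_ref + state_kl + stage_cost - next_value - lr_star\<close>. Each term has an integrable
  upper bound: the induction hypothesis serves \<open>- next_value\<close>, the general bound on
  log-ratios serves \<open>- lr_star\<close>.\<close>

lemma chat_neg_part:
  assumes pu: "pu \<in> policies N X U" and fin: "finite_terms pu"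
    and "k \<le> N"
  shows "integrable (measure_pmf (xm pu k)) (\<lambda>x. max 0 (- ch k x))"
  using \<open>k \<le> N\<close>
proof (induction k rule: inc_induct)
  case base
  show ?case by (simp add: chat_N)
next
  case (step n)
  have k: "Suc n \<in> {1..N}"
    using step.hyps by simp
  have dom: "dominated pu" and int: "integrable (measure_pmf (xum pu (Suc n))) (lr_ref pu (Suc n))"
      "integrable (measure_pmf (xum pu (Suc n))) (state_kl (Suc n))"
      "integrable (measure_pmf (xum pu (Suc n))) (\<lambda>xu. max 0 (stage_cost (Suc n) xu))"
    using fin k by (auto simp: finite_terms_def)
  note e = next_value_neg_part[OF pu k step.IH]
  have "integrable (measure_pmf (xum pu (Suc n))) (\<lambda>xu. max 0 (- ch (Suc n - 1) (fst xu)))"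
  proof (rule integrable_pmf_bound)
    show "integrable (measure_pmf (xum pu (Suc n))) (\<lambda>xu. \<bar>lr_ref pu (Suc n) xu\<bar> + state_kl (Suc n) xu
        + max 0 (stage_cost (Suc n) xu) + max 0 (- next_value (Suc n) xu) + max 0 (- lr_star pu (Suc n) xu))"
      by (intro Bochner_Integration.integrable_add integrable_abs e neg_parts_integrable[OF k] int)
    show "\<bar>max 0 (- ch (Suc n - 1) (fst xu))\<bar> \<le> \<bar>lr_ref pu (Suc n) xu\<bar> + state_kl (Suc n) xu
        + max 0 (stage_cost (Suc n) xu) + max 0 (- next_value (Suc n) xu) + max 0 (- lr_star pu (Suc n) xu)"
      if xu: "xu \<in> set_pmf (xum pu (Suc n))" for xu
      using lr_star_dominated[OF pu dom k xu] state_kl_nonneg[of "Suc n" xu]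
      by linarith
  qed
  then show ?case
    using integrable_xum_fst(1)[OF k, of pu "\<lambda>x. max 0 (- ch (Suc n - 1) x)"] by simp
qed

definition regular :: "(nat \<Rightarrow> 'x \<Rightarrow> 'u pmf) \<Rightarrow> nat \<Rightarrow> bool" where
  "regular pu k \<longleftrightarrow>
     integrable (measure_pmf (xum pu k)) (lr_ref pu k) \<and> integrable (measure_pmf (xum pu k)) (state_kl k) \<and>
     integrable (measure_pmf (xum pu k)) (stage_cost k) \<and> integrable (measure_pmf (xum pu k)) (next_value k) \<and>
     integrable (measure_pmf (xum pu k)) (lr_star pu k)"

text \<open>Solving the stage identity for \<open>- stage_cost\<close> bounds the negative part of
  the cost, so the cost is integrable. Then \<open>lr_star + next_value\<close> is integrable and
  splits, as both terms have integrable negative parts.\<close>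

lemma regular_step:
  assumes pu: "pu \<in> policies N X U" and fin: "finite_terms pu" and k: "k \<in> {1..N}"
    and ch: "integrable (measure_pmf (xm pu (k - 1))) (ch (k - 1))"
  shows "regular pu k" "integrable (measure_pmf (xm pu k)) (ch k)"
proof -
  let ?M = "measure_pmf (xum pu k)"
  have dom: "dominated pu" and int: "integrable ?M (lr_ref pu k)" "integrable ?M (state_kl k)"
      "integrable ?M (\<lambda>xu. max 0 (stage_cost k xu))"
    using fin k by (auto simp: finite_terms_def)
  have ch': "integrable ?M (\<lambda>xu. ch (k - 1) (fst xu))"
    using ch integrable_xum_fst(1)[OF k, of pu "ch (k - 1)"] by simp
  have neg: "integrable (measure_pmf (xm pu k)) (\<lambda>x. max 0 (- ch k x))"
    using k by (intro chat_neg_part[OF pu fin]) simp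
  note e = next_value_neg_part[OF pu k neg] and eq = lr_star_dominated[OF pu dom k]
  have l: "integrable ?M (stage_cost k)"
  proof (rule integrable_pmf_bound)
    show "integrable ?M (\<lambda>xu. \<bar>lr_ref pu k xu\<bar> + state_kl k xu + \<bar>ch (k - 1) (fst xu)\<bar>
        + max 0 (stage_cost k xu) + max 0 (- next_value k xu) + max 0 (- lr_star pu k xu))"
      by (intro Bochner_Integration.integrable_add integrable_abs e neg_parts_integrable[OF k] int ch')
    show "\<bar>stage_cost k xu\<bar> \<le> \<bar>lr_ref pu k xu\<bar> + state_kl k xu + \<bar>ch (k - 1) (fst xu)\<bar>
        + max 0 (stage_cost k xu) + max 0 (- next_value k xu) + max 0 (- lr_star pu k xu)"
      if xu: "xu \<in> set_pmf (xum pu k)" for xu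
      using eq[OF xu] state_kl_nonneg[of k xu] by linarith
  qed
  have "integrable ?M (\<lambda>xu. lr_star pu k xu + next_value k xu) \<longleftrightarrow>
      integrable ?M (\<lambda>xu. lr_ref pu k xu + state_kl k xu + stage_cost k xu + ch (k - 1) (fst xu))"
    by (rule integrable_pmf_cong) (use eq in auto)
  then have "integrable ?M (\<lambda>xu. lr_star pu k xu + next_value k xu)"
    using int l ch' by (simp add: Bochner_Integration.integrable_add)
  from integrable_add_lower_bounded[OF this neg_parts_integrable(2)[OF k] e]
  show "regular pu k" and "integrable (measure_pmf (xm pu k)) (ch k)"
    using int l chat_step_neg[OF pu k _ neg] by (auto simp: regular_def)
qed

lemma regular_step_opt:
  assumes cost: "\<And>k. k \<in> {1..N} \<Longrightarrow> integrable (measure_pmf (xum opt k)) (stage_cost k)"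
    and k: "k \<in> {1..N}" and ch: "integrable (measure_pmf (xm opt (k - 1))) (ch (k - 1))"
  shows "regular opt k" "integrable (measure_pmf (xm opt k)) (ch k)"
proof -
  let ?M = "measure_pmf (xum opt k)"
  have ch': "integrable ?M (\<lambda>xu. ch (k - 1) (fst xu))"
    using ch integrable_xum_fst(1)[OF k, of opt "ch (k - 1)"] by simp
  have pos: "integrable (measure_pmf (xm opt k)) (\<lambda>x. max 0 (ch k x))"
    using k by (intro chat_pos_part_opt[OF cost]) simp_all
  note e = next_value_pos_part[OF opt_in_policies k pos] and l = cost[OF k]
  have eq: "next_value k xu = lr_ref opt k xu + state_kl k xu + stage_cost k xu + ch (k - 1) (fst xu)"
    if "xu \<in> set_pmf (xum opt k)" for xu
    using lr_star_dominated[OF opt_in_policies dominated_opt k that] lr_star_opt[OF k that] by simp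
  have next_value: "integrable ?M (next_value k)"
  proof (rule integrable_pmf_bound)
    show "integrable ?M (\<lambda>xu. max 0 (next_value k xu) + max 0 (- lr_ref opt k xu) + \<bar>stage_cost k xu\<bar> + \<bar>ch (k - 1) (fst xu)\<bar>)"
      by (intro Bochner_Integration.integrable_add integrable_abs e neg_parts_integrable[OF k] ch' l)
    show "\<bar>next_value k xu\<bar> \<le> max 0 (next_value k xu) + max 0 (- lr_ref opt k xu) + \<bar>stage_cost k xu\<bar> + \<bar>ch (k - 1) (fst xu)\<bar>"
      if xu: "xu \<in> set_pmf (xum opt k)" for xu
      using eq[OF xu] state_kl_nonneg[of k xu] by linarith
  qed
  have "integrable ?M (\<lambda>xu. lr_ref opt k xu + state_kl k xu) \<longleftrightarrow>
      integrable ?M (\<lambda>xu. next_value k xu - stage_cost k xu - ch (k - 1) (fst xu))"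
    by (rule integrable_pmf_cong) (use eq in auto)
  then have sum: "integrable ?M (\<lambda>xu. lr_ref opt k xu + state_kl k xu)"
    using next_value l ch' by (simp add: Bochner_Integration.integrable_diff)
  have "max 0 (- state_kl k xu) = 0" for xu
    using state_kl_nonneg[of k xu] by simp
  then have "integrable ?M (\<lambda>xu. max 0 (- state_kl k xu))"
    by simp
  note qd = integrable_add_lower_bounded[OF sum neg_parts_integrable(1)[OF k] this]
  have "integrable ?M (lr_star opt k)"
    by (subst integrable_pmf_cong[OF lr_star_opt[OF k]]) simp_all
  then show "regular opt k"
    using qd next_value l by (simp add: regular_def)
  show "integrable (measure_pmf (xm opt k)) (ch k)"
    by (rule chat_step_pos[OF opt_in_policies k next_value pos])
qed

lemma regular_all:
  assumes step: "\<And>k. k \<in> {1..N} \<Longrightarrow> integrable (measure_pmf (xm pu (k - 1))) (ch (k - 1)) \<Longrightarrow>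
      regular pu k \<and> integrable (measure_pmf (xm pu k)) (ch k)"
    and ch0: "integrable (measure_pmf p0) (ch 0)"
  shows "k \<le> N \<Longrightarrow> integrable (measure_pmf (xm pu k)) (ch k)"
    and "k \<in> {1..N} \<Longrightarrow> regular pu k"
proof -
  show *: "integrable (measure_pmf (xm pu k)) (ch k)" if "k \<le> N" for k
    using that by (induction k) (use ch0 step in \<open>force simp: state_marginal_0\<close>)+
  show "regular pu k" if k: "k \<in> {1..N}"
  proof -
    have "k - 1 \<le> N"
      using k by auto
    then show ?thesis
      using step[OF k *] by blast
  qed
qed

section \<open>Decomposition of the objective\<close>

lemma kl_finite_xum:
  assumes "pu \<in> policies N X U" "k \<in> {1..N}" "(x, u) \<in> set_pmf (xum pu k)"
  shows "kl (px k u x) (qx k u x) \<noteq> \<infinity>"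
  using input_reachable[OF assms(1,2)] assms(2,3) kl_finite by blast

text \<open>In \<open>ereal\<close> infinity absorbs even minus infinity, so an objective other than
  infinity has no infinite positive summand.\<close>

lemma objective_finite_terms:
  assumes pu: "pu \<in> policies N X U" and fin: "J pu \<noteq> \<infinity>"
  shows "kl p0 q0 \<noteq> \<infinity>" "finite_terms pu"
proof -
  have kl: "kl (joint_pmf p0 px pu N) (joint_pmf q0 qx qu N) \<noteq> \<infinity>"
    and s: "(\<Sum>k=1..N. ext_expectation (xum pu k) (stage_cost k)) \<noteq> \<infinity>"
    using fin by (auto simp: objective_def stage_cost_def)
  have "ext_expectation (xum pu k) (stage_cost k) \<noteq> \<infinity>" if "k \<in> {1..N}" for k
    using s that by (auto simp: sum_Pinfty)
  then have "integrable (measure_pmf (xum pu k)) (\<lambda>xu. max 0 (stage_cost k xu))" if "k \<in> {1..N}" for k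
    using that ext_expectation_finite by blast
  then show "kl p0 q0 \<noteq> \<infinity>" "finite_terms pu"
    using kl kl_joint_pmf[of N p0 px pu qx q0 qu, OF kl_finite_xum[OF pu]]
    by (auto simp: finite_terms_def dominated_def lr_ref_def state_kl_def)
qed

lemma objective_eq:
  assumes pu: "pu \<in> policies N X U" and dom: "dominated pu" and kl: "kl p0 q0 \<noteq> \<infinity>"
    and reg: "\<And>k. k \<in> {1..N} \<Longrightarrow> regular pu k"
    and ch: "\<And>k. k \<le> N \<Longrightarrow> integrable (measure_pmf (xm pu k)) (ch k)"
  shows "J pu = kl p0 q0 + ereal ((\<Sum>k=1..N. measure_pmf.expectation (xum pu k) (lr_star pu k))
      - measure_pmf.expectation p0 (ch 0))"
proof -
  let ?E = "\<lambda>k. measure_pmf.expectation (xum pu k)" and ?C = "\<lambda>k. measure_pmf.expectation (xm pu k) (ch k)"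
  have "kl (joint_pmf p0 px pu N) (joint_pmf q0 qx qu N)
      = kl p0 q0 + ereal (\<Sum>k=1..N. ?E k (lr_ref pu k) + ?E k (state_kl k))"
    using kl reg dom kl_joint_pmf[of N p0 px pu qx q0 qu, OF kl_finite_xum[OF pu]]
    by (simp add: dominated_def regular_def lr_ref_def state_kl_def)
  moreover have "(\<Sum>k=1..N. ext_expectation (xum pu k) (stage_cost k)) = ereal (\<Sum>k=1..N. ?E k (stage_cost k))"
    using reg by (simp add: regular_def ext_expectation_eq)
  ultimately have J: "J pu = kl p0 q0 + ereal (\<Sum>k=1..N. ?E k (lr_ref pu k) + ?E k (state_kl k) + ?E k (stage_cost k))"
    by (simp add: objective_def stage_cost_def add.assoc sum.distrib)
  have stage: "?E k (lr_ref pu k) + ?E k (state_kl k) + ?E k (stage_cost k) = ?E k (lr_star pu k) + (?C k - ?C (k - 1))"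
    if k: "k \<in> {1..N}" for k
  proof -
    have int: "integrable (measure_pmf (xum pu k)) (lr_ref pu k)" "integrable (measure_pmf (xum pu k)) (state_kl k)"
        "integrable (measure_pmf (xum pu k)) (stage_cost k)" "integrable (measure_pmf (xum pu k)) (next_value k)"
        "integrable (measure_pmf (xum pu k)) (lr_star pu k)"
      using reg[OF k] by (auto simp: regular_def)
    have "k - 1 \<le> N"
      using k by auto
    then have ch': "integrable (measure_pmf (xum pu k)) (\<lambda>xu. ch (k - 1) (fst xu))"
      using ch integrable_xum_fst(1)[OF k, of pu "ch (k - 1)"] by blast
    have "?E k (lr_star pu k) = ?E k (\<lambda>xu. lr_ref pu k xu + state_kl k xu + stage_cost k xu - next_value k xu + ch (k - 1) (fst xu))"
      by (rule integral_pmf_cong) (rule lr_star_dominated[OF pu dom k])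
    also have "\<dots> = ?E k (lr_ref pu k) + ?E k (state_kl k) + ?E k (stage_cost k) - ?E k (next_value k)
        + ?E k (\<lambda>xu. ch (k - 1) (fst xu))"
      using int ch' by simp
    also have "?E k (next_value k) = ?C k"
      using k by (intro integral_next_value[OF pu k] ch) simp
    also have "?E k (\<lambda>xu. ch (k - 1) (fst xu)) = ?C (k - 1)"
      by (rule integrable_xum_fst(2)[OF k])
    finally show ?thesis
      by simp
  qed
  have telescope: "(\<Sum>k=1..n. f k - f (k - 1)) = f n - f 0" for f :: "nat \<Rightarrow> real" and n
    by (induction n) simp_all
  have "(\<Sum>k=1..N. ?E k (lr_ref pu k) + ?E k (state_kl k) + ?E k (stage_cost k))
      = (\<Sum>k=1..N. ?E k (lr_star pu k) + (?C k - ?C (k - 1)))"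
    by (rule sum.cong[OF refl]) (rule stage)
  also have "\<dots> = (\<Sum>k=1..N. ?E k (lr_star pu k)) + (\<Sum>k=1..N. ?C k - ?C (k - 1))"
    by (rule sum.distrib)
  also have "(\<Sum>k=1..N. ?C k - ?C (k - 1)) = ?C N - ?C 0"
    by (rule telescope)
  \<comment> \<open>\<open>?C N\<close> vanishes by the terminal condition, and \<open>?C 0\<close>
    is taken under \<open>p0\<close>, which is the same for all policies.\<close>
  finally show ?thesis
    unfolding J by (simp add: state_marginal_0 chat_N)
qed

lemma integral_lr_star:
  assumes pu: "pu \<in> policies N X U" and dom: "dominated pu" and k: "k \<in> {1..N}"
    and reg: "regular pu k"
  shows "0 \<le> measure_pmf.expectation (xum pu k) (lr_star pu k)"
    and "measure_pmf.expectation (xum pu k) (lr_star pu k) = 0 \<Longrightarrow> x \<in> set_pmf (xm pu (k - 1)) \<Longrightarrow>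
      pu k x = opt k x"
proof -
  have sub: "set_pmf (pu k x) \<subseteq> set_pmf (opt k x)" if "x \<in> set_pmf (xm pu (k - 1))" for x
  proof -
    have "k - 1 \<le> N"
      using k by auto
    from state_reachable[OF pu this] have "x \<in> X"
      using that by blast
    then show ?thesis
      using dom that k set_opt[OF k] by (simp add: dominated_def)
  qed
  have int: "integrable (measure_pmf (pair_kernel (xm pu (k - 1)) (pu k))) (\<lambda>(x, u). lr (pu k x) (opt k x) u)"
    using reg by (simp add: regular_def lr_star_def state_input_marginal_eq[OF k])
  show "0 \<le> measure_pmf.expectation (xum pu k) (lr_star pu k)"
    using integral_pair_kernel_lr(1)[OF sub int] by (simp add: lr_star_def state_input_marginal_eq[OF k])
  show "pu k x = opt k x"
    if "measure_pmf.expectation (xum pu k) (lr_star pu k) = 0" "x \<in> set_pmf (xm pu (k - 1))"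
    using integral_pair_kernel_lr(2)[OF sub int] that by (simp add: lr_star_def state_input_marginal_eq[OF k])
qed

text \<open>Equality in Gibbs' inequality gives agreement at the states visited under
  \<open>pu\<close>. By forward induction these are the states visited under the candidate, where
  uniqueness is stated.\<close>

lemma state_marginal_eq_opt:
  assumes eq: "\<And>k x. k \<in> {1..N} \<Longrightarrow> x \<in> set_pmf (xm pu (k - 1)) \<Longrightarrow> pu k x = opt k x"
    and "k \<le> N"
  shows "xm pu k = xm opt k"
  using \<open>k \<le> N\<close>
proof (induction k)
  case 0
  show ?case by (simp add: state_marginal_0)
next
  case (Suc k)
  have k: "Suc k \<in> {1..N}"
    using Suc.prems by simp
  have "xum pu (Suc k) = xum opt (Suc k)"
    unfolding state_input_marginal_eq[OF k] pair_kernel_def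
    by (rule bind_pmf_cong) (use Suc eq[OF k] in auto)
  then show ?case
    by (simp add: state_marginal_step[OF k])
qed

text \<open>The two backward inductions run along different policies, but both have initial law
  \<open>p0\<close>, so the bound on the positive part and the bound on the negative part combine at
  time 0.\<close>

lemma chat_0_integrable:
  assumes cost: "\<And>k. k \<in> {1..N} \<Longrightarrow> integrable (measure_pmf (xum opt k)) (stage_cost k)"
    and pu: "pu \<in> policies N X U" "J pu \<noteq> \<infinity>"
  shows "integrable (measure_pmf p0) (ch 0)"
  using chat_pos_part_opt[OF cost, of 0] chat_neg_part[OF pu(1) objective_finite_terms(2)[OF pu], of 0]
  unfolding state_marginal_0 integrable_pos_neg_parts[of p0 "ch 0"] by blast

section \<open>Optimality, uniqueness and the one-stage minima\<close>

context
  assumes cost: "\<And>k. k \<in> {1..N} \<Longrightarrow> integrable (measure_pmf (xum opt k)) (stage_cost k)"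
    and kl0: "kl p0 q0 \<noteq> \<infinity>" and ch0: "integrable (measure_pmf p0) (ch 0)"
begin

text \<open>The forward induction starts from \<open>ch0\<close>. The context assumes
  \<open>ch0\<close> rather than a policy of finite cost, so that the one-stage problems can supply
  it directly.\<close>

lemma chat_integrable_opt: "k \<le> N \<Longrightarrow> integrable (measure_pmf (xm opt k)) (ch k)"
  and regular_opt: "k \<in> {1..N} \<Longrightarrow> regular opt k"
  using regular_all[of opt k] regular_step_opt[OF cost] ch0 by blast+

lemma objective_opt: "J opt = kl p0 q0 - ereal (measure_pmf.expectation p0 (ch 0))"
proof -
  have "measure_pmf.expectation (xum opt k) (lr_star opt k) = 0" if "k \<in> {1..N}" for k
    using integral_pmf_cong[OF lr_star_opt[OF that]] by simp
  then show ?thesis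
    using objective_eq[OF opt_in_policies dominated_opt kl0 regular_opt chat_integrable_opt]
    by (simp add: minus_ereal_def)
qed

text \<open>The excess of \<open>J pu\<close> over \<open>J opt\<close> is the sum of the means of
  \<open>lr_star\<close>, each nonnegative by Gibbs' inequality; without excess every term is
  zero.\<close>

lemma objective_ge:
  assumes pu: "pu \<in> policies N X U"
  shows "J opt \<le> J pu"
    and "J pu \<le> J opt \<Longrightarrow> k \<in> {1..N} \<Longrightarrow> x \<in> set_pmf (xm opt (k - 1)) \<Longrightarrow> pu k x = opt k x"
proof -
  obtain a where a: "kl p0 q0 = ereal a"
    using kl0 kl_eq by blast
  let ?s = "\<lambda>k. measure_pmf.expectation (xum pu k) (lr_star pu k)"
  have main: "dominated pu \<and> (\<forall>k\<in>{1..N}. regular pu k) \<and>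
      J pu = J opt + ereal (\<Sum>k=1..N. ?s k)" if "J pu \<noteq> \<infinity>"
  proof -
    note fin = objective_finite_terms(2)[OF pu that]
    have dom: "dominated pu"
      using fin by (simp add: finite_terms_def)
    have *: "k \<le> N \<Longrightarrow> integrable (measure_pmf (xm pu k)) (ch k)" "k \<in> {1..N} \<Longrightarrow> regular pu k" for k
      using regular_all[of pu k] regular_step[OF pu fin] ch0 by blast+
    have "J pu = kl p0 q0 + ereal ((\<Sum>k=1..N. ?s k) - measure_pmf.expectation p0 (ch 0))"
      by (rule objective_eq[OF pu dom kl0 *(2,1)])
    then show ?thesis
      using dom *(2) by (simp add: objective_opt a)
  qed
  have nonneg: "0 \<le> ?s k" if "J pu \<noteq> \<infinity>" "k \<in> {1..N}" for k
    using main[OF that(1)] integral_lr_star(1)[OF pu] that(2) by blast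
  show "J opt \<le> J pu"
  proof (cases "J pu = \<infinity>")
    case False
    then have "0 \<le> (\<Sum>k=1..N. ?s k)"
      using nonneg by (intro sum_nonneg) auto
    then show ?thesis
      using main[OF False] by (simp add: objective_opt a)
  qed simp
  assume le: "J pu \<le> J opt" and kx: "k \<in> {1..N}" "x \<in> set_pmf (xm opt (k - 1))"
  \<comment> \<open>\<open>J opt\<close> is a real number, so \<open>pu\<close> has finite cost and
    \<open>main\<close> applies.\<close>
  have fin: "J pu \<noteq> \<infinity>"
    using le by (auto simp: objective_opt a)
  have "(\<Sum>k=1..N. ?s k) \<le> 0"
    using le main[OF fin] by (simp add: objective_opt a)
  moreover have "0 \<le> (\<Sum>k=1..N. ?s k)"
    using nonneg[OF fin] by (intro sum_nonneg) auto
  ultimately have "(\<Sum>k=1..N. ?s k) = 0"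
    by simp
  then have 0: "?s k = 0" if "k \<in> {1..N}" for k
    using nonneg[OF fin] that by (subst (asm) sum_nonneg_eq_0_iff) auto
  have eq: "pu k x = opt k x" if "k \<in> {1..N}" "x \<in> set_pmf (xm pu (k - 1))" for k x
    using integral_lr_star(2)[OF pu _ that(1) _ 0[OF that(1)] that(2)] main[OF fin] that(1) by blast
  have "xm pu (k - 1) = xm opt (k - 1)"
    by (rule state_marginal_eq_opt) (use eq kx in auto)
  then show "pu k x = opt k x"
    using eq kx by simp
qed

text \<open>With horizon 1, cost \<open>cbar\<close> and equal initial pmfs, the terminal
  \<open>chat\<close> and the initial divergence vanish, so the one-stage problem has the normaliser
  and the candidate of stage \<open>k\<close>; \<open>objective_opt\<close> then gives its
  value.\<close>

lemma single_stage_min: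
  assumes k: "k \<in> {1..N}"
  defines "pbar \<equiv> xm opt (k - 1)"
  shows "(INF r\<in>policies 1 X U. objective 1 pbar (\<lambda>_. px k) pbar (\<lambda>_. qx k) (\<lambda>_. qu k)
      (\<lambda>_. cbar N px qx qu c k) r) = ereal (- measure_pmf.expectation pbar (ch (k - 1)))"
proof -
  have k1: "k - 1 \<le> N"
    using k by auto
  have cb: "cbar 1 (\<lambda>_. px k) (\<lambda>_. qx k) (\<lambda>_. qu k) (\<lambda>_. cbar N px qx qu c k) 1 = cbar N px qx qu c k"
    by (rule ext) (simp add: cbar_def chat_terminal)
  interpret S: kl_control_problem 1 X U pbar pbar "\<lambda>_. px k" "\<lambda>_. qx k" "\<lambda>_. qu k" "\<lambda>_. cbar N px qx qu c k"
  proof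
    show "set_pmf pbar \<subseteq> X"
      unfolding pbar_def by (rule state_reachable[OF opt_in_policies k1])
    show "(\<lambda>_. qu k) \<in> policies 1 X U"
      using set_qu[OF k] by (auto simp: policies_def)
  next
    fix j :: nat and u x assume "j \<in> {1..1}" and ux: "u \<in> U" "x \<in> X"
    then have j: "j = 1"
      by simp
    show "set_pmf (px k u x) \<subseteq> X"
      by (rule px_sub[OF k ux])
    show "kl (px k u x) (qx k u x) \<noteq> \<infinity>"
      by (rule kl_finite[OF k ux])
    show "integrable (measure_pmf (px k u x)) (cbar N px qx qu c k)"
      by (rule cbar_sum[OF k ux])
    then show "integrable (measure_pmf (px k u x))
        (cbar 1 (\<lambda>_. px k) (\<lambda>_. qx k) (\<lambda>_. qu k) (\<lambda>_. cbar N px qx qu c k) j)"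
      by (simp only: j cb)
  next
    fix j :: nat and x assume "j \<in> {1..1}" and x: "x \<in> X"
    then have j: "j = 1"
      by simp
    show "integrable (measure_pmf (qu k x)) (\<lambda>u. exp (- real_of_ereal (kl (px k u x) (qx k u x))
        - measure_pmf.expectation (px k u x)
            (cbar 1 (\<lambda>_. px k) (\<lambda>_. qx k) (\<lambda>_. qu k) (\<lambda>_. cbar N px qx qu c k) j)))"
      using exp_sum[OF k x] by (simp only: j cb)
  qed
  have ch: "S.ch 0 = ch (k - 1)"
  proof
    fix x
    have "S.Z 1 x = Z k x"
      by (simp only: Z_def S.Z_def cb)
    then show "S.ch 0 x = ch (k - 1) x"
      using chat_eq_ln_Z[OF k, of x] S.chat_eq_ln_Z[of 1 x] by simp
  qed
  have opt: "S.opt 1 = opt k"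
    by (rule ext) (simp only: opt_policy_def pu_star_def[abs_def] pu_bar_def[abs_def] cb)
  have "S.xum S.opt 1 = xum opt k"
    using k by (simp add: state_input_marginal_eq state_marginal_0 opt[simplified] pbar_def)
  \<comment> \<open>The one-stage cost is the conditional mean of \<open>cbar\<close>, that is,
    stage cost minus next value; both are integrable by regularity of the full candidate.\<close>
  moreover have "integrable (measure_pmf (xum opt k)) (S.stage_cost 1)"
  proof (subst integrable_pmf_cong)
    show "integrable (measure_pmf (xum opt k)) (\<lambda>xu. stage_cost k xu - next_value k xu)"
      using regular_opt[OF k] by (auto simp: regular_def)
    show "S.stage_cost 1 xu = stage_cost k xu - next_value k xu" if "xu \<in> set_pmf (xum opt k)" for xu
      using that input_reachable[OF opt_in_policies k] chat_integrable(2)[OF k]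
      by (cases xu) (auto simp: S.stage_cost_def)
  qed
  ultimately have cost_S: "integrable (measure_pmf (S.xum S.opt j)) (S.stage_cost j)" if "j \<in> {1..1}" for j
    using that by simp
  have kl_S: "kl pbar pbar \<noteq> \<infinity>"
    by (simp add: kl_self)
  have ch_S: "integrable (measure_pmf pbar) (S.ch 0)"
    unfolding ch pbar_def by (rule chat_integrable_opt[OF k1])
  have "(INF r\<in>policies 1 X U. S.J r) = S.J S.opt"
    by (rule antisym)
      (use S.opt_in_policies S.objective_ge(1)[OF cost_S kl_S ch_S]
        in \<open>auto intro: INF_lower INF_greatest\<close>)
  also have "\<dots> = ereal (- measure_pmf.expectation pbar (ch (k - 1)))"
    using S.objective_opt[OF cost_S kl_S ch_S] unfolding kl_self ch by simp
  finally show ?thesis .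
qed

end

end

theorem theorem1:
  fixes N :: nat
    and X :: "(int ^ 'n) set" and U :: "(int ^ 'p) set"
    and p0 q0 :: "(int ^ 'n) pmf"
    and px qx :: "nat \<Rightarrow> int ^ 'p \<Rightarrow> int ^ 'n \<Rightarrow> (int ^ 'n) pmf"
    and qu :: "nat \<Rightarrow> int ^ 'n \<Rightarrow> (int ^ 'p) pmf"
    and c :: "nat \<Rightarrow> int ^ 'n \<Rightarrow> real"
  assumes N: "N \<ge> 1"
    and p0: "set_pmf p0 \<subseteq> X" and q0: "set_pmf q0 \<subseteq> X"
    and px: "\<And>k u x. k \<in> {1..N} \<Longrightarrow> u \<in> U \<Longrightarrow> x \<in> X \<Longrightarrow> set_pmf (px k u x) \<subseteq> X"
    and qx: "\<And>k u x. k \<in> {1..N} \<Longrightarrow> u \<in> U \<Longrightarrow> x \<in> X \<Longrightarrow> set_pmf (qx k u x) \<subseteq> X"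
    and qu: "qu \<in> policies N X U"
    \<comment> \<open>the sums appearing in the objective and in the recursion exist\<close>
    and kl_finite: "\<And>k u x. k \<in> {1..N} \<Longrightarrow> u \<in> U \<Longrightarrow> x \<in> X \<Longrightarrow> kl (px k u x) (qx k u x) \<noteq> \<infinity>"
    and c_sum: "\<And>k u x. k \<in> {1..N} \<Longrightarrow> u \<in> U \<Longrightarrow> x \<in> X \<Longrightarrow>
        integrable (measure_pmf (px k u x)) (c k)"
    and cbar_sum: "\<And>k u x. k \<in> {1..N} \<Longrightarrow> u \<in> U \<Longrightarrow> x \<in> X \<Longrightarrow>
        integrable (measure_pmf (px k u x)) (cbar N px qx qu c k)"
    and exp_sum: "\<And>k x. k \<in> {1..N} \<Longrightarrow> x \<in> X \<Longrightarrow>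
        integrable (measure_pmf (qu k x)) (\<lambda>u. exp (- real_of_ereal (kl (px k u x) (qx k u x))
          - measure_pmf.expectation (px k u x) (cbar N px qx qu c k)))"
    and cost_sum: "\<And>k. k \<in> {1..N} \<Longrightarrow>
        integrable (measure_pmf (state_input_marginal p0 px (opt_policy N px qx qu c) N k))
          (\<lambda>(x, u). measure_pmf.expectation (px k u x) (c k))"
    \<comment> \<open>the optimal cost is bounded\<close>
    and bounded: "\<bar>INF pu\<in>policies N X U. objective N p0 px q0 qx qu c pu\<bar> \<noteq> \<infinity>"
  shows
    \<comment> \<open>(i): the candidate is given by the stated formula, is feasible and optimal, and is unique\<close>
    "(\<forall>k\<in>{1..N}. \<forall>x\<in>X. \<forall>u.
        pmf (opt_policy N px qx qu c k x) u = pu_star N px qx qu c k x u)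
     \<and> is_arg_min (objective N p0 px q0 qx qu c) (\<lambda>pu. pu \<in> policies N X U)
          (opt_policy N px qx qu c)
     \<and> (\<forall>pu. is_arg_min (objective N p0 px q0 qx qu c) (\<lambda>pu. pu \<in> policies N X U) pu \<longrightarrow>
          (\<forall>k\<in>{1..N}. \<forall>x\<in>set_pmf (state_marginal p0 px (opt_policy N px qx qu c) N (k - 1)).
             pu k x = opt_policy N px qx qu c k x))
     \<comment> \<open>(ii): the minimum of the problem; the sum of the expectations of \<open>chat (k - 1)\<close> over
         all \<open>k\<close> is (up to sign) the sum of the minima of the one-stage problems of the backward
         recursion, which in general is not the minimum of the problem\<close>
     \<and> (\<forall>k\<in>{1..N}.
          integrable (measure_pmf (state_marginal p0 px (opt_policy N px qx qu c) N (k - 1)))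
            (chat N px qx qu c (k - 1)))
     \<and> objective N p0 px q0 qx qu c (opt_policy N px qx qu c)
          = kl p0 q0 - ereal (measure_pmf.expectation
              (state_marginal p0 px (opt_policy N px qx qu c) N 0) (chat N px qx qu c 0))
     \<and> (\<Sum>k=1..N.
          let pbar = state_marginal p0 px (opt_policy N px qx qu c) N (k - 1)
          in INF r\<in>policies 1 X U.
               objective 1 pbar (\<lambda>_. px k) pbar (\<lambda>_. qx k) (\<lambda>_. qu k)
                 (\<lambda>_. cbar N px qx qu c k) r)
        = ereal (- (\<Sum>k=1..N. measure_pmf.expectation
            (state_marginal p0 px (opt_policy N px qx qu c) N (k - 1))
            (chat N px qx qu c (k - 1))))"
proof -
  interpret kl_control_problem N X U p0 q0 px qx qu c
    using p0 px qu kl_finite c_sum cbar_sum exp_sum by unfold_locales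
  have cost: "integrable (measure_pmf (xum opt k)) (stage_cost k)" if "k \<in> {1..N}" for k
    using cost_sum[OF that] by (simp add: stage_cost_def)
  \<comment> \<open>If every policy had cost infinity, so would the infimum, which is over a
    nonempty set because the candidate is feasible.\<close>
  obtain pu where pu: "pu \<in> policies N X U" "J pu \<noteq> \<infinity>"
  proof (rule ccontr)
    assume "\<not> thesis"
    then have "(INF pu\<in>policies N X U. J pu) = \<infinity>"
      using that by (auto intro!: INF_eq_const[where x = \<infinity>] opt_in_policies simp: top_ereal_def)
    then show False
      using bounded by simp
  qed
  note kl0 = objective_finite_terms(1)[OF pu] and ch0 = chat_0_integrable[OF cost pu]
  note opt_ge = objective_ge[OF cost kl0 ch0]
  have "is_arg_min J (\<lambda>pu. pu \<in> policies N X U) opt"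
    using opt_in_policies opt_ge(1) by (auto simp: is_arg_min_def not_less)
  \<comment> \<open>Minimality of \<open>pu'\<close> says that the candidate is not strictly better,
    which in a linear order is \<open>J pu' \<le> J opt\<close>.\<close>
  moreover have "pu' k x = opt k x"
    if "is_arg_min J (\<lambda>pu. pu \<in> policies N X U) pu'" "k \<in> {1..N}" "x \<in> set_pmf (xm opt (k - 1))"
    for pu' k x
    using that opt_ge(2)[of pu' k x] opt_in_policies by (auto simp: is_arg_min_def not_less)
  moreover have "integrable (measure_pmf (xm opt (k - 1))) (ch (k - 1))" if "k \<in> {1..N}" for k
    by (rule chat_integrable_opt[OF cost kl0 ch0]) (use that in auto)
  moreover have "J opt = kl p0 q0 - ereal (measure_pmf.expectation (xm opt 0) (ch 0))"
    unfolding state_marginal_0 by (rule objective_opt[OF cost kl0 ch0])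
  moreover have "(\<Sum>k=1..N.
      let pbar = xm opt (k - 1)
      in INF r\<in>policies 1 X U. objective 1 pbar (\<lambda>_. px k) pbar (\<lambda>_. qx k) (\<lambda>_. qu k)
        (\<lambda>_. cbar N px qx qu c k) r)
    = (\<Sum>k=1..N. ereal (- measure_pmf.expectation (xm opt (k - 1)) (ch (k - 1))))"
    unfolding Let_def by (rule sum.cong[OF refl]) (rule single_stage_min[OF cost kl0 ch0])
  then have "(\<Sum>k=1..N.
      let pbar = xm opt (k - 1)
      in INF r\<in>policies 1 X U. objective 1 pbar (\<lambda>_. px k) pbar (\<lambda>_. qx k) (\<lambda>_. qu k)
        (\<lambda>_. cbar N px qx qu c k) r)
    = ereal (- (\<Sum>k=1..N. measure_pmf.expectation (xm opt (k - 1)) (ch (k - 1))))"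
    by (simp only: sum_ereal sum_negf)
  ultimately show ?thesis
    using pmf_opt by blast
qed

end
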